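(* Let $\Bbbk$ be a commutative ring of characteristic not equal to two and $z\in\Bbbk$. The superfunctor $\mathcal{Q}(z)\to\mathcal{AQ}(z)$ that is the identity on objects and sends each generating morphism $u^+,u^-,r^-,\mathrm{cap}_L,\mathrm{cup}_L,c$ of $\mathcal{Q}(z)$ to the morphism of $\mathcal{AQ}(z)$ of the same name is faithful.
   Context: Everything is $\Bbbk$-linear. A supercategory is a category enriched in vector superspaces ($\mathbb{Z}/2$-graded $\Bbbk$-modules) with parity-preserving maps; $\bar f$ is the parity of a homogeneous $f$. In a strict monoidal supercategory (unit $\mathbb{1}$, identities $1_X$) the super interchange law holds: $(f'\otimes g)\circ(f\otimes g')=(-1)^{\bar f\bar g}(f'\circ f)\otimes(g\circ g')$. The quantum isomeric supercategory $\mathcal{Q}(z)$ is the strict monoidal supercategory generated by objects $\uparrow,\downarrow$; even morphisms $u^+,u^-\colon\uparrow\otimes\uparrow\to\uparrow\otimes\uparrow$, $r^-\colon\uparrow\otimes\downarrow\to\downarrow\otimes\uparrow$, $\mathrm{cap}_L\colon\downarrow\otimes\uparrow\to\mathbb{1}$, $\mathrm{cup}_L\colon\mathbb{1}\to\uparrow\otimes\downarrow$; and an odd morphism $c\colon\uparrow\to\uparrow$; subject to: $u^-u^+=1=u^+u^-$; $l^+r^-=1_{\uparrow\otimes\downarrow}$; $r^-l^+=1_{\downarrow\otimes\uparrow}$; $(u^+\otimes1_\uparrow)(1_\uparrow\otimes u^+)(u^+\otimes1_\uparrow)=(1_\uparrow\otimes u^+)(u^+\otimes1_\uparrow)(1_\uparrow\otimes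 u^+)$; $u^+-u^-=z\,1_{\uparrow\otimes\uparrow}$; $c^2=-1_\uparrow$; $u^+(c\otimes1_\uparrow)=(1_\uparrow\otimes c)u^+$; $\mathrm{cap}_R(c\otimes1_\downarrow)\mathrm{cup}_L=0=\mathrm{cap}_R\,\mathrm{cup}_L$; $(1_\uparrow\otimes\mathrm{cap}_L)(\mathrm{cup}_L\otimes1_\uparrow)=1_\uparrow$; $(\mathrm{cap}_L\otimes1_\downarrow)(1_\downarrow\otimes\mathrm{cup}_L)=1_\downarrow$, where $l^+:=(\mathrm{cap}_L\otimes1_\uparrow\otimes1_\downarrow)(1_\downarrow\otimes u^+\otimes1_\downarrow)(1_\downarrow\otimes1_\uparrow\otimes\mathrm{cup}_L)\colon\downarrow\otimes\uparrow\to\uparrow\otimes\downarrow$ and $\mathrm{cap}_R:=\mathrm{cap}_L\circ r^-\colon\uparrow\otimes\downarrow\to\mathbb{1}$. The quantum affine isomeric supercategory $\mathcal{AQ}(z)$ is the strict monoidal supercategory obtained from $\mathcal{Q}(z)$ by adjoining an additional odd morphism $o\colon\uparrow\to\uparrow$ subject to $o^2=-1_\uparrow$, $u^+(1_\uparrow\otimes o)=(o\otimes1_\uparrow)u^+$, $\mathrm{cap}_R(o\otimes1_\downarrow)\mathrm{cup}_L=0$. *)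

theory Defs
  imports Main
begin

section \<open>Strict monoidal supercategories\<close>

text \<open>
  All objects of the type \<open>'o\<close> are objects of the category, and the ground ring is the
  commutative ring \<open>'k\<close>. Parities are booleans: \<open>False\<close> is even, \<open>True\<close> is odd, and the sum of
  two parities \<open>p\<close>, \<open>q\<close> is \<open>p \<noteq> q\<close>. The set \<open>part C X Y p\<close> is the parity \<open>p\<close> part of the
  superspace of morphisms \<open>hom C X Y\<close>; zero morphisms carry their source and target, and
  \<open>comp C f g\<close> is \<open>f \<circ> g\<close>.
\<close>

record ('k, 'o, 'm) smcat =
  hom :: "'o \<Rightarrow> 'o \<Rightarrow> 'm set"
  part :: "'o \<Rightarrow> 'o \<Rightarrow> bool \<Rightarrow> 'm set"
  zero :: "'o \<Rightarrow> 'o \<Rightarrow> 'm"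
  add :: "'m \<Rightarrow> 'm \<Rightarrow> 'm"
  scale :: "'k \<Rightarrow> 'm \<Rightarrow> 'm"
  ident :: "'o \<Rightarrow> 'm"
  comp :: "'m \<Rightarrow> 'm \<Rightarrow> 'm"
  unit :: "'o"
  tensor_ob :: "'o \<Rightarrow> 'o \<Rightarrow> 'o"
  tensor :: "'m \<Rightarrow> 'm \<Rightarrow> 'm"

definition koszul_sign :: "bool \<Rightarrow> bool \<Rightarrow> 'k::comm_ring_1" where
  "koszul_sign p q = (if p \<and> q then - 1 else 1)"

locale strict_monoidal_supercategory =
  fixes C :: "('k::comm_ring_1, 'o, 'm) smcat"
  assumes zero_hom: "zero C X Y \<in> hom C X Y"
    and add_hom: "\<lbrakk>f \<in> hom C X Y; g \<in> hom C X Y\<rbrakk> \<Longrightarrow> add C f g \<in> hom C X Y"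
    and scale_hom: "f \<in> hom C X Y \<Longrightarrow> scale C a f \<in> hom C X Y"
    and add_assoc: "\<lbrakk>f \<in> hom C X Y; g \<in> hom C X Y; h \<in> hom C X Y\<rbrakk>
          \<Longrightarrow> add C (add C f g) h = add C f (add C g h)"
    and add_commute: "\<lbrakk>f \<in> hom C X Y; g \<in> hom C X Y\<rbrakk> \<Longrightarrow> add C f g = add C g f"
    and add_zero: "f \<in> hom C X Y \<Longrightarrow> add C f (zero C X Y) = f"
    and add_neg: "f \<in> hom C X Y \<Longrightarrow> add C f (scale C (- 1) f) = zero C X Y"
    and scale_add: "\<lbrakk>f \<in> hom C X Y; g \<in> hom C X Y\<rbrakk>
          \<Longrightarrow> scale C a (add C f g) = add C (scale C a f) (scale C a g)"
    and scale_plus: "f \<in> hom C X Y \<Longrightarrow> scale C (a + b) f = add C (scale C a f) (scale C b f)"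
    and scale_scale: "f \<in> hom C X Y \<Longrightarrow> scale C a (scale C b f) = scale C (a * b) f"
    and scale_one: "f \<in> hom C X Y \<Longrightarrow> scale C 1 f = f"
    and part_hom: "part C X Y p \<subseteq> hom C X Y"
    and zero_part: "zero C X Y \<in> part C X Y p"
    and add_part: "\<lbrakk>f \<in> part C X Y p; g \<in> part C X Y p\<rbrakk> \<Longrightarrow> add C f g \<in> part C X Y p"
    and scale_part: "f \<in> part C X Y p \<Longrightarrow> scale C a f \<in> part C X Y p"
    and direct_sum: "f \<in> hom C X Y \<Longrightarrow>
          \<exists>!u. fst u \<in> part C X Y False \<and> snd u \<in> part C X Y True \<and> f = add C (fst u) (snd u)"
    and ident_part: "ident C X \<in> part C X X False"
    and comp_hom: "\<lbrakk>f \<in> hom C Y Z; g \<in> hom C X Y\<rbrakk> \<Longrightarrow> comp C f g \<in> hom C X Z"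
    and comp_part: "\<lbrakk>f \<in> part C Y Z p; g \<in> part C X Y q\<rbrakk> \<Longrightarrow> comp C f g \<in> part C X Z (p \<noteq> q)"
    and comp_assoc: "\<lbrakk>f \<in> hom C Y Z; g \<in> hom C X Y; h \<in> hom C W X\<rbrakk>
          \<Longrightarrow> comp C (comp C f g) h = comp C f (comp C g h)"
    and ident_comp: "f \<in> hom C X Y \<Longrightarrow> comp C (ident C Y) f = f"
    and comp_ident: "f \<in> hom C X Y \<Longrightarrow> comp C f (ident C X) = f"
    and comp_add_left: "\<lbrakk>f \<in> hom C Y Z; f' \<in> hom C Y Z; g \<in> hom C X Y\<rbrakk>
          \<Longrightarrow> comp C (add C f f') g = add C (comp C f g) (comp C f' g)"
    and comp_add_right: "\<lbrakk>f \<in> hom C Y Z; g \<in> hom C X Y; g' \<in> hom C X Y\<rbrakk>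
          \<Longrightarrow> comp C f (add C g g') = add C (comp C f g) (comp C f g')"
    and comp_scale_left: "\<lbrakk>f \<in> hom C Y Z; g \<in> hom C X Y\<rbrakk>
          \<Longrightarrow> comp C (scale C a f) g = scale C a (comp C f g)"
    and comp_scale_right: "\<lbrakk>f \<in> hom C Y Z; g \<in> hom C X Y\<rbrakk>
          \<Longrightarrow> comp C f (scale C a g) = scale C a (comp C f g)"
    and tensor_ob_assoc:
          "tensor_ob C (tensor_ob C X Y) Z = tensor_ob C X (tensor_ob C Y Z)"
    and unit_tensor_ob: "tensor_ob C (unit C) X = X"
    and tensor_ob_unit: "tensor_ob C X (unit C) = X"
    and tensor_hom: "\<lbrakk>f \<in> hom C X Y; g \<in> hom C V W\<rbrakk>
          \<Longrightarrow> tensor C f g \<in> hom C (tensor_ob C X V) (tensor_ob C Y W)"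
    and tensor_part: "\<lbrakk>f \<in> part C X Y p; g \<in> part C V W q\<rbrakk>
          \<Longrightarrow> tensor C f g \<in> part C (tensor_ob C X V) (tensor_ob C Y W) (p \<noteq> q)"
    and tensor_assoc: "\<lbrakk>f \<in> hom C X Y; g \<in> hom C V W; h \<in> hom C S T\<rbrakk>
          \<Longrightarrow> tensor C (tensor C f g) h = tensor C f (tensor C g h)"
    and unit_tensor: "f \<in> hom C X Y \<Longrightarrow> tensor C (ident C (unit C)) f = f"
    and tensor_unit: "f \<in> hom C X Y \<Longrightarrow> tensor C f (ident C (unit C)) = f"
    and tensor_ident: "tensor C (ident C X) (ident C Y) = ident C (tensor_ob C X Y)"
    and tensor_add_left: "\<lbrakk>f \<in> hom C X Y; f' \<in> hom C X Y; g \<in> hom C V W\<rbrakk>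
          \<Longrightarrow> tensor C (add C f f') g = add C (tensor C f g) (tensor C f' g)"
    and tensor_add_right: "\<lbrakk>f \<in> hom C X Y; g \<in> hom C V W; g' \<in> hom C V W\<rbrakk>
          \<Longrightarrow> tensor C f (add C g g') = add C (tensor C f g) (tensor C f g')"
    and tensor_scale_left: "\<lbrakk>f \<in> hom C X Y; g \<in> hom C V W\<rbrakk>
          \<Longrightarrow> tensor C (scale C a f) g = scale C a (tensor C f g)"
    and tensor_scale_right: "\<lbrakk>f \<in> hom C X Y; g \<in> hom C V W\<rbrakk>
          \<Longrightarrow> tensor C f (scale C a g) = scale C a (tensor C f g)"
    and super_interchange:
          "\<lbrakk>f' \<in> hom C Y Z; f \<in> part C X Y p; g \<in> part C V W q; g' \<in> hom C U V\<rbrakk>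
          \<Longrightarrow> comp C (tensor C f' g) (tensor C f g')
              = scale C (koszul_sign p q) (tensor C (comp C f' f) (comp C g g'))"

definition strict_monoidal_superfunctor ::
  "('k, 'o, 'm) smcat \<Rightarrow> ('k, 'p, 'n) smcat \<Rightarrow> ('o \<Rightarrow> 'p) \<Rightarrow> ('m \<Rightarrow> 'n) \<Rightarrow> bool" where
  "strict_monoidal_superfunctor C D FO F \<longleftrightarrow>
     (\<forall>X Y f. f \<in> hom C X Y \<longrightarrow> F f \<in> hom D (FO X) (FO Y)) \<and>
     (\<forall>X Y p f. f \<in> part C X Y p \<longrightarrow> F f \<in> part D (FO X) (FO Y) p) \<and>
     (\<forall>X Y f g. f \<in> hom C X Y \<longrightarrow> g \<in> hom C X Y \<longrightarrow> F (add C f g) = add D (F f) (F g)) \<and>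
     (\<forall>X Y a f. f \<in> hom C X Y \<longrightarrow> F (scale C a f) = scale D a (F f)) \<and>
     (\<forall>X. F (ident C X) = ident D (FO X)) \<and>
     (\<forall>X Y Z f g. f \<in> hom C Y Z \<longrightarrow> g \<in> hom C X Y \<longrightarrow> F (comp C f g) = comp D (F f) (F g)) \<and>
     FO (unit C) = unit D \<and>
     (\<forall>X Y. FO (tensor_ob C X Y) = tensor_ob D (FO X) (FO Y)) \<and>
     (\<forall>X Y V W f g. f \<in> hom C X Y \<longrightarrow> g \<in> hom C V W \<longrightarrow>
        F (tensor C f g) = tensor D (F f) (F g))"

definition faithful :: "('k, 'o, 'm) smcat \<Rightarrow> ('m \<Rightarrow> 'n) \<Rightarrow> bool" where
  "faithful C F \<longleftrightarrow> (\<forall>X Y. inj_on F (hom C X Y))"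


section \<open>Generators and relations\<close>

text \<open>
  Objects are words (lists) in the generating objects \<open>'o\<close>. Morphisms are represented by formal
  terms in the generating morphisms \<open>'g\<close>.
\<close>

datatype (dead 'k, dead 'o, 'g) trm =
    Gen 'g
  | Id "'o list"
  | Zero "'o list" "'o list"
  | Add "('k, 'o, 'g) trm" "('k, 'o, 'g) trm"
  | Scale 'k "('k, 'o, 'g) trm"
  | Comp "('k, 'o, 'g) trm" "('k, 'o, 'g) trm" (infixl \<open>\<bullet>\<close> 65)
  | Tens "('k, 'o, 'g) trm" "('k, 'o, 'g) trm" (infixl \<open>\<otimes>\<close> 70)
  for map: rename

record ('k, 'o, 'g) presentation =
  gsrc :: "'g \<Rightarrow> 'o list"
  gtgt :: "'g \<Rightarrow> 'o list"
  gpar :: "'g \<Rightarrow> bool"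
  rels :: "('k, 'o, 'g) trm rel"

primrec src :: "('k, 'o, 'g) presentation \<Rightarrow> ('k, 'o, 'g) trm \<Rightarrow> 'o list" where
  "src P (Gen g) = gsrc P g"
| "src P (Id X) = X"
| "src P (Zero X Y) = X"
| "src P (Add f g) = src P f"
| "src P (Scale a f) = src P f"
| "src P (f \<bullet> g) = src P g"
| "src P (f \<otimes> g) = src P f @ src P g"

primrec tgt :: "('k, 'o, 'g) presentation \<Rightarrow> ('k, 'o, 'g) trm \<Rightarrow> 'o list" where
  "tgt P (Gen g) = gtgt P g"
| "tgt P (Id X) = X"
| "tgt P (Zero X Y) = Y"
| "tgt P (Add f g) = tgt P f"
| "tgt P (Scale a f) = tgt P f"
| "tgt P (f \<bullet> g) = tgt P f"
| "tgt P (f \<otimes> g) = tgt P f @ tgt P g"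

primrec wt :: "('k, 'o, 'g) presentation \<Rightarrow> ('k, 'o, 'g) trm \<Rightarrow> bool" where
  "wt P (Gen g) \<longleftrightarrow> True"
| "wt P (Id X) \<longleftrightarrow> True"
| "wt P (Zero X Y) \<longleftrightarrow> True"
| "wt P (Add f g) \<longleftrightarrow> wt P f \<and> wt P g \<and> src P f = src P g \<and> tgt P f = tgt P g"
| "wt P (Scale a f) \<longleftrightarrow> wt P f"
| "wt P (f \<bullet> g) \<longleftrightarrow> wt P f \<and> wt P g \<and> src P f = tgt P g"
| "wt P (f \<otimes> g) \<longleftrightarrow> wt P f \<and> wt P g"

definition arrow ::
  "('k, 'o, 'g) presentation \<Rightarrow> 'o list \<Rightarrow> 'o list \<Rightarrow> ('k, 'o, 'g) trm \<Rightarrow> bool" where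
  "arrow P X Y t \<longleftrightarrow> wt P t \<and> src P t = X \<and> tgt P t = Y"

inductive homog :: "('k, 'o, 'g) presentation \<Rightarrow> bool \<Rightarrow> ('k, 'o, 'g) trm \<Rightarrow> bool"
  for P :: "('k, 'o, 'g) presentation" where
  "homog P (gpar P g) (Gen g)"
| "homog P False (Id X)"
| "homog P p (Zero X Y)"
| "homog P p f \<Longrightarrow> homog P p g \<Longrightarrow> homog P p (Add f g)"
| "homog P p f \<Longrightarrow> homog P p (Scale a f)"
| "homog P p f \<Longrightarrow> homog P q g \<Longrightarrow> homog P (p \<noteq> q) (f \<bullet> g)"
| "homog P p f \<Longrightarrow> homog P q g \<Longrightarrow> homog P (p \<noteq> q) (f \<otimes> g)"

text \<open>
  The congruence on well-typed terms generated by the axioms of a strict monoidal supercategory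
  and by the given relations.
\<close>

inductive eqv ::
  "('k::comm_ring_1, 'o, 'g) presentation \<Rightarrow> ('k, 'o, 'g) trm \<Rightarrow> ('k, 'o, 'g) trm \<Rightarrow> bool"
  for P :: "('k, 'o, 'g) presentation" where
  rel: "(l, r) \<in> rels P \<Longrightarrow> eqv P l r"
| refl: "wt P f \<Longrightarrow> eqv P f f"
| sym: "eqv P f g \<Longrightarrow> eqv P g f"
| trans: "eqv P f g \<Longrightarrow> eqv P g h \<Longrightarrow> eqv P f h"
| cong_Add: "eqv P f f' \<Longrightarrow> eqv P g g' \<Longrightarrow> wt P (Add f g) \<Longrightarrow> eqv P (Add f g) (Add f' g')"
| cong_Scale: "eqv P f f' \<Longrightarrow> eqv P (Scale a f) (Scale a f')"
| cong_Comp: "eqv P f f' \<Longrightarrow> eqv P g g' \<Longrightarrow> wt P (f \<bullet> g) \<Longrightarrow> eqv P (f \<bullet> g) (f' \<bullet> g')"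
| cong_Tens: "eqv P f f' \<Longrightarrow> eqv P g g' \<Longrightarrow> eqv P (f \<otimes> g) (f' \<otimes> g')"
| Add_assoc: "wt P (Add (Add f g) h) \<Longrightarrow> eqv P (Add (Add f g) h) (Add f (Add g h))"
| Add_commute: "wt P (Add f g) \<Longrightarrow> eqv P (Add f g) (Add g f)"
| Add_zero: "arrow P X Y f \<Longrightarrow> eqv P (Add f (Zero X Y)) f"
| Add_neg: "arrow P X Y f \<Longrightarrow> eqv P (Add f (Scale (- 1) f)) (Zero X Y)"
| Scale_add: "wt P (Add f g) \<Longrightarrow> eqv P (Scale a (Add f g)) (Add (Scale a f) (Scale a g))"
| Scale_plus: "wt P f \<Longrightarrow> eqv P (Scale (a + b) f) (Add (Scale a f) (Scale b f))"
| Scale_Scale: "wt P f \<Longrightarrow> eqv P (Scale a (Scale b f)) (Scale (a * b) f)"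
| Scale_one: "wt P f \<Longrightarrow> eqv P (Scale 1 f) f"
| Comp_assoc: "wt P (f \<bullet> g \<bullet> h) \<Longrightarrow> eqv P (f \<bullet> g \<bullet> h) (f \<bullet> (g \<bullet> h))"
| Id_Comp: "arrow P X Y f \<Longrightarrow> eqv P (Id Y \<bullet> f) f"
| Comp_Id: "arrow P X Y f \<Longrightarrow> eqv P (f \<bullet> Id X) f"
| Comp_Add_left: "wt P (Add f f' \<bullet> g) \<Longrightarrow> eqv P (Add f f' \<bullet> g) (Add (f \<bullet> g) (f' \<bullet> g))"
| Comp_Add_right: "wt P (f \<bullet> Add g g') \<Longrightarrow> eqv P (f \<bullet> Add g g') (Add (f \<bullet> g) (f \<bullet> g'))"
| Comp_Scale_left: "wt P (f \<bullet> g) \<Longrightarrow> eqv P (Scale a f \<bullet> g) (Scale a (f \<bullet> g))"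
| Comp_Scale_right: "wt P (f \<bullet> g) \<Longrightarrow> eqv P (f \<bullet> Scale a g) (Scale a (f \<bullet> g))"
| Tens_assoc: "wt P (f \<otimes> g \<otimes> h) \<Longrightarrow> eqv P (f \<otimes> g \<otimes> h) (f \<otimes> (g \<otimes> h))"
| Unit_Tens: "wt P f \<Longrightarrow> eqv P (Id [] \<otimes> f) f"
| Tens_Unit: "wt P f \<Longrightarrow> eqv P (f \<otimes> Id []) f"
| Tens_Id: "eqv P (Id X \<otimes> Id Y) (Id (X @ Y))"
| Tens_Add_left: "wt P (Add f f' \<otimes> g) \<Longrightarrow> eqv P (Add f f' \<otimes> g) (Add (f \<otimes> g) (f' \<otimes> g))"
| Tens_Add_right: "wt P (f \<otimes> Add g g') \<Longrightarrow> eqv P (f \<otimes> Add g g') (Add (f \<otimes> g) (f \<otimes> g'))"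
| Tens_Scale_left: "wt P (f \<otimes> g) \<Longrightarrow> eqv P (Scale a f \<otimes> g) (Scale a (f \<otimes> g))"
| Tens_Scale_right: "wt P (f \<otimes> g) \<Longrightarrow> eqv P (f \<otimes> Scale a g) (Scale a (f \<otimes> g))"
| Interchange: "wt P (f' \<bullet> f) \<Longrightarrow> wt P (g \<bullet> g') \<Longrightarrow> homog P p f \<Longrightarrow> homog P q g \<Longrightarrow>
    eqv P ((f' \<otimes> g) \<bullet> (f \<otimes> g')) (Scale (koszul_sign p q) ((f' \<bullet> f) \<otimes> (g \<bullet> g')))"

definition cls ::
  "('k::comm_ring_1, 'o, 'g) presentation \<Rightarrow> ('k, 'o, 'g) trm \<Rightarrow> ('k, 'o, 'g) trm set" where
  "cls P t = {t'. eqv P t t'}"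

definition presented ::
  "('k::comm_ring_1, 'o, 'g) presentation \<Rightarrow> ('k, 'o list, ('k, 'o, 'g) trm set) smcat" where
  "presented P = \<lparr>
     hom = (\<lambda>X Y. cls P ` {t. arrow P X Y t}),
     part = (\<lambda>X Y p. cls P ` {t. arrow P X Y t \<and> homog P p t}),
     zero = (\<lambda>X Y. cls P (Zero X Y)),
     add = (\<lambda>A B. \<Union>f\<in>A. \<Union>g\<in>B. cls P (Add f g)),
     scale = (\<lambda>a A. \<Union>f\<in>A. cls P (Scale a f)),
     ident = (\<lambda>X. cls P (Id X)),
     comp = (\<lambda>A B. \<Union>f\<in>A. \<Union>g\<in>B. cls P (f \<bullet> g)),
     unit = [],
     tensor_ob = (@),
     tensor = (\<lambda>A B. \<Union>f\<in>A. \<Union>g\<in>B. cls P (f \<otimes> g))\<rparr>"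

text \<open>
  The map on morphisms, from a presented category to the category presented by \<open>P\<close>, that is
  induced by a map \<open>\<sigma>\<close> on generators.
\<close>

definition induced ::
  "('k::comm_ring_1, 'o, 'h) presentation \<Rightarrow> ('g \<Rightarrow> 'h) \<Rightarrow>
   ('k, 'o, 'g) trm set \<Rightarrow> ('k, 'o, 'h) trm set" where
  "induced P \<sigma> A = (\<Union>t\<in>A. cls P (rename \<sigma> t))"

definition admissible :: "('k::comm_ring_1, 'o, 'g) presentation \<Rightarrow> bool" where
  "admissible P \<longleftrightarrow> (\<forall>(l, r) \<in> rels P.
     wt P l \<and> wt P r \<and> src P l = src P r \<and> tgt P l = tgt P r \<and>
     (\<exists>p. homog P p l \<and> homog P p r))"

subsection \<open>The presented category is a strict monoidal supercategory\<close>

lemma homog_Gen: "gpar P g = p \<Longrightarrow> homog P p (Gen g)"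
  using homog.intros(1)[of P g] by simp

lemma homog_Comp: "homog P q f \<Longrightarrow> homog P r g \<Longrightarrow> p = (q \<noteq> r) \<Longrightarrow> homog P p (f \<bullet> g)"
  using homog.intros(6)[of P q f r g] by simp

lemma homog_Tens: "homog P q f \<Longrightarrow> homog P r g \<Longrightarrow> p = (q \<noteq> r) \<Longrightarrow> homog P p (f \<otimes> g)"
  using homog.intros(7)[of P q f r g] by simp

primrec proj :: "('k, 'o, 'g) presentation \<Rightarrow> bool \<Rightarrow> ('k, 'o, 'g) trm \<Rightarrow> ('k, 'o, 'g) trm" where
  "proj P p (Gen g) = (if gpar P g = p then Gen g else Zero (gsrc P g) (gtgt P g))"
| "proj P p (Id X) = (if p then Zero X X else Id X)"
| "proj P p (Zero X Y) = Zero X Y"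
| "proj P p (Add f g) = Add (proj P p f) (proj P p g)"
| "proj P p (Scale a f) = Scale a (proj P p f)"
| "proj P p (f \<bullet> g) = Add (proj P p f \<bullet> proj P False g) (proj P (\<not> p) f \<bullet> proj P True g)"
| "proj P p (f \<otimes> g) = Add (proj P p f \<otimes> proj P False g) (proj P (\<not> p) f \<otimes> proj P True g)"

context
  fixes P :: "('k::comm_ring_1, 'o, 'g) presentation"
  assumes P: "admissible P"
begin

lemma eqv_typed: "eqv P f g \<Longrightarrow> wt P f \<and> wt P g \<and> src P f = src P g \<and> tgt P f = tgt P g"
  by (induction rule: eqv.induct)
    (use P in \<open>auto simp: admissible_def arrow_def\<close>)

lemma eqv_arrow: "eqv P f g \<Longrightarrow> arrow P X Y f \<longleftrightarrow> arrow P X Y g"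
  using eqv_typed[of f g] by (auto simp: arrow_def)

lemma src_proj [simp]: "src P (proj P p f) = src P f"
  by (induction f arbitrary: p) auto

lemma tgt_proj [simp]: "tgt P (proj P p f) = tgt P f"
  by (induction f arbitrary: p) auto

lemma wt_proj [simp]: "wt P f \<Longrightarrow> wt P (proj P p f)"
  by (induction f arbitrary: p) auto

lemma homog_proj: "homog P p (proj P p f)"
proof (induction f arbitrary: p)
  case (Gen g)
  then show ?case by (auto intro: homog.intros)
next
  case (Comp f g)
  have "homog P (p \<noteq> False) (proj P p f \<bullet> proj P False g)"
    "homog P ((\<not> p) \<noteq> True) (proj P (\<not> p) f \<bullet> proj P True g)"
    by (rule homog.intros Comp)+
  then show ?case by (auto intro: homog.intros)
next
  case (Tens f g)
  have "homog P (p \<noteq> False) (proj P p f \<otimes> proj P False g)"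
    "homog P ((\<not> p) \<noteq> True) (proj P (\<not> p) f \<otimes> proj P True g)"
    by (rule homog.intros Tens)+
  then show ?case by (auto intro: homog.intros)
qed (auto intro: homog.intros)

lemma Add_cong: "eqv P f f' \<Longrightarrow> eqv P g g' \<Longrightarrow> src P f = src P g \<Longrightarrow> tgt P f = tgt P g
   \<Longrightarrow> eqv P (Add f g) (Add f' g')"
  by (rule eqv.cong_Add) (auto dest: eqv_typed)

lemma Comp_cong: "eqv P f f' \<Longrightarrow> eqv P g g' \<Longrightarrow> src P f = tgt P g \<Longrightarrow> eqv P (f \<bullet> g) (f' \<bullet> g')"
  by (rule eqv.cong_Comp) (auto dest: eqv_typed)

lemmas Tens_cong = eqv.cong_Tens[where P = P]
lemmas Scale_cong = eqv.cong_Scale[where P = P]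
lemmas tr = eqv.trans[where P = P]

declare eqv.trans [trans]

lemma zero_Add: "arrow P X Y f \<Longrightarrow> eqv P (Add (Zero X Y) f) f"
  by (rule tr[OF eqv.Add_commute eqv.Add_zero]) (auto simp: arrow_def)

lemma Add4:
  assumes "arrow P X Y a" "arrow P X Y b" "arrow P X Y c" "arrow P X Y d"
  shows "eqv P (Add (Add a b) (Add c d)) (Add (Add a c) (Add b d))"
proof -
  note [simp] = assms[unfolded arrow_def]
  have "eqv P (Add (Add a b) (Add c d)) (Add a (Add b (Add c d)))"
    by (rule eqv.Add_assoc) simp
  also have "eqv P \<dots> (Add a (Add (Add b c) d))"
    by (intro Add_cong eqv.refl eqv.sym[OF eqv.Add_assoc]) simp_all
  also have "eqv P \<dots> (Add a (Add (Add c b) d))"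
    by (intro Add_cong eqv.refl eqv.Add_commute) simp_all
  also have "eqv P \<dots> (Add a (Add c (Add b d)))"
    by (intro Add_cong eqv.refl eqv.Add_assoc) simp_all
  also have "eqv P \<dots> (Add (Add a c) (Add b d))"
    by (intro eqv.sym[OF eqv.Add_assoc]) simp_all
  finally show ?thesis .
qed

lemma Add_left_zero:
  assumes "arrow P X Y f" "eqv P f (Add f f)"
  shows "eqv P f (Zero X Y)"
proof -
  note [simp] = assms(1)[unfolded arrow_def]
  let ?n = "Scale (- 1) f"
  have "eqv P f (Add f (Zero X Y))"
    by (rule eqv.sym[OF eqv.Add_zero[OF assms(1)]])
  also have "eqv P \<dots> (Add f (Add f ?n))"
    by (intro Add_cong eqv.refl eqv.sym[OF eqv.Add_neg[OF assms(1)]]) simp_all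
  also have "eqv P \<dots> (Add (Add f f) ?n)"
    by (intro eqv.sym[OF eqv.Add_assoc]) simp_all
  also have "eqv P \<dots> (Add f ?n)"
    by (intro Add_cong eqv.refl eqv.sym[OF assms(2)]) simp_all
  also have "eqv P \<dots> (Zero X Y)"
    by (rule eqv.Add_neg[OF assms(1)])
  finally show ?thesis .
qed

lemma ZZ: "eqv P (Zero X Y) (Add (Zero X Y) (Zero X Y))"
  by (rule eqv.sym, rule eqv.Add_zero) (simp add: arrow_def)

lemma Scale_Zero: "eqv P (Scale a (Zero X Y)) (Zero X Y)"
  by (rule Add_left_zero, simp add: arrow_def,
      rule tr[OF Scale_cong[OF ZZ] eqv.Scale_add]) simp

lemma Comp_Zero: "arrow P Y Z f \<Longrightarrow> eqv P (f \<bullet> Zero X Y) (Zero X Z)"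
  by (rule Add_left_zero, simp add: arrow_def,
      rule tr[OF Comp_cong[OF eqv.refl ZZ] eqv.Comp_Add_right]) (simp_all add: arrow_def)

lemma Zero_Comp: "arrow P X Y f \<Longrightarrow> eqv P (Zero Y Z \<bullet> f) (Zero X Z)"
  by (rule Add_left_zero, simp add: arrow_def,
      rule tr[OF Comp_cong[OF ZZ eqv.refl] eqv.Comp_Add_left]) (simp_all add: arrow_def)

lemma Tens_Zero: "arrow P X Y f \<Longrightarrow> eqv P (f \<otimes> Zero V W) (Zero (X @ V) (Y @ W))"
  by (rule Add_left_zero, simp add: arrow_def,
      rule tr[OF Tens_cong[OF eqv.refl ZZ] eqv.Tens_Add_right]) (simp_all add: arrow_def)

lemma Zero_Tens: "arrow P X Y f \<Longrightarrow> eqv P (Zero V W \<otimes> f) (Zero (V @ X) (W @ Y))"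
  by (rule Add_left_zero, simp add: arrow_def,
      rule tr[OF Tens_cong[OF ZZ eqv.refl] eqv.Tens_Add_left]) (simp_all add: arrow_def)

lemma Scale_zero:
  assumes "arrow P X Y f" shows "eqv P (Scale 0 f) (Zero X Y)"
  by (rule Add_left_zero)
    (use assms eqv.Scale_plus[where P = P and a = 0 and b = 0 and f = f]
      in \<open>simp_all add: arrow_def\<close>)

lemma eqv_zero_left:
  "eqv P f (Zero X Y) \<Longrightarrow> eqv P g h \<Longrightarrow> arrow P X Y h \<Longrightarrow> eqv P (Add f g) h"
  by (rule tr[OF Add_cong[of f "Zero X Y" g h] zero_Add])
    (use eqv_typed in \<open>force simp: arrow_def\<close>)+

lemma eqv_zero_right:
  "eqv P f (Zero X Y) \<Longrightarrow> eqv P g h \<Longrightarrow> arrow P X Y h \<Longrightarrow> eqv P (Add g f) h"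
  by (rule tr[OF Add_cong[of g h f "Zero X Y"] eqv.Add_zero])
    (use eqv_typed in \<open>force simp: arrow_def\<close>)+

text \<open>A homogeneous term has only one nonzero component.\<close>

lemma proj_homog:
  "homog P p f \<Longrightarrow> wt P f \<Longrightarrow>
    eqv P (proj P p f) f \<and> eqv P (proj P (\<not> p) f) (Zero (src P f) (tgt P f))"
proof (induction rule: homog.induct)
  case (4 p f g)
  let ?Z = "Zero (src P f) (tgt P f)"
  have "eqv P (Add (proj P (\<not> p) f) (proj P (\<not> p) g)) ?Z"
    using 4 by (intro eqv_zero_left[where X = "src P f" and Y = "tgt P f"]) (auto simp: arrow_def)
  with 4 show ?case by (auto intro: Add_cong)
next
  case (5 p f a)
  then show ?case by (auto intro: Scale_cong tr[OF Scale_cong Scale_Zero])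
next
  case (6 p f q g)
  have *: "wt P f" "wt P g" "src P f = tgt P g" using 6 by auto
  let ?Z = "Zero (src P g) (tgt P f)"
  have Z1: "eqv P (proj P (\<not> p) f \<bullet> t) ?Z" if "arrow P (src P g) (src P f) t" for t
    by (rule tr[OF Comp_cong Zero_Comp]) (use 6 * that in \<open>auto simp: arrow_def intro: eqv.refl\<close>)
  have Z2: "eqv P (t \<bullet> proj P (\<not> q) g) ?Z" if "arrow P (tgt P g) (tgt P f) t" for t
    by (rule tr[OF Comp_cong Comp_Zero]) (use 6 * that in \<open>auto simp: arrow_def intro: eqv.refl\<close>)
  have N: "eqv P (proj P p f \<bullet> proj P q g) (f \<bullet> g)"
    using 6 * by (auto intro: Comp_cong)
  have A: "arrow P (src P g) (tgt P f) (f \<bullet> g)" "arrow P (src P g) (tgt P f) ?Z"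
    "\<And>r. arrow P (src P g) (src P f) (proj P r g)" "\<And>r. arrow P (tgt P g) (tgt P f) (proj P r f)"
    using * by (auto simp: arrow_def)
  show ?case
    using Z1[OF A(3)] Z2[OF A(4)] N A(1,2)
    by (cases p; cases q) (auto intro: eqv_zero_left eqv_zero_right)
next
  case (7 p f q g)
  have *: "wt P f" "wt P g" using 7 by auto
  let ?Z = "Zero (src P f @ src P g) (tgt P f @ tgt P g)"
  have Z1: "eqv P (proj P (\<not> p) f \<otimes> t) ?Z" if "arrow P (src P g) (tgt P g) t" for t
    by (rule tr[OF Tens_cong Zero_Tens]) (use 7 * that in \<open>auto simp: arrow_def intro: eqv.refl\<close>)
  have Z2: "eqv P (t \<otimes> proj P (\<not> q) g) ?Z" if "arrow P (src P f) (tgt P f) t" for t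
    by (rule tr[OF Tens_cong Tens_Zero]) (use 7 * that in \<open>auto simp: arrow_def intro: eqv.refl\<close>)
  have N: "eqv P (proj P p f \<otimes> proj P q g) (f \<otimes> g)"
    using 7 * by (auto intro: Tens_cong)
  have A: "arrow P (src P f @ src P g) (tgt P f @ tgt P g) (f \<otimes> g)"
    "arrow P (src P f @ src P g) (tgt P f @ tgt P g) ?Z"
    "\<And>r. arrow P (src P g) (tgt P g) (proj P r g)" "\<And>r. arrow P (src P f) (tgt P f) (proj P r f)"
    using * by (auto simp: arrow_def)
  show ?case
    using Z1[OF A(3)] Z2[OF A(4)] N A(1,2)
    by (cases p; cases q) (auto intro: eqv_zero_left eqv_zero_right)
qed (auto intro: eqv.refl)

lemma proj_same: "homog P p f \<Longrightarrow> wt P f \<Longrightarrow> eqv P (proj P p f) f"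
  using proj_homog by blast

lemma proj_other: "homog P p f \<Longrightarrow> wt P f \<Longrightarrow> q \<noteq> p \<Longrightarrow> eqv P (proj P q f) (Zero (src P f) (tgt P f))"
  using proj_homog[of p f] by (cases p; cases q) auto

lemma eqv_proj_sum: "wt P f \<Longrightarrow> eqv P (Add (proj P False f) (proj P True f)) f"
proof (induction f)
  case (Gen g)
  then show ?case by (auto intro: eqv.Add_zero zero_Add simp: arrow_def)
next
  case (Id X)
  then show ?case by (auto intro: eqv.Add_zero zero_Add simp: arrow_def)
next
  case (Zero X Y)
  then show ?case by (auto intro: eqv.Add_zero zero_Add simp: arrow_def)
next
  case (Add f g)
  then show ?case
    by (auto intro!: tr[OF Add4[where X = "src P f" and Y = "tgt P f"] Add_cong] simp: arrow_def)
next
  case (Scale a f)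
  then show ?case
    by (auto intro!: tr[OF eqv.sym[OF eqv.Scale_add] Scale_cong])
next
  case (Comp f g)
  then have *: "wt P f" "wt P g" "src P f = tgt P g" by auto
  let ?f0 = "proj P False f" and ?f1 = "proj P True f"
    and ?g0 = "proj P False g" and ?g1 = "proj P True g"
  have "eqv P (Add (Add (?f0 \<bullet> ?g0) (?f1 \<bullet> ?g1)) (Add (?f1 \<bullet> ?g0) (?f0 \<bullet> ?g1)))
     (Add (Add (?f0 \<bullet> ?g0) (?f1 \<bullet> ?g0)) (Add (?f1 \<bullet> ?g1) (?f0 \<bullet> ?g1)))"
    by (rule Add4) (use * in \<open>auto simp: arrow_def\<close>)
  also have "eqv P \<dots> (Add (Add (?f0 \<bullet> ?g0) (?f1 \<bullet> ?g0)) (Add (?f0 \<bullet> ?g1) (?f1 \<bullet> ?g1)))"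
    by (intro Add_cong eqv.refl eqv.Add_commute) (use * in simp_all)
  also have "eqv P \<dots> (Add (Add ?f0 ?f1 \<bullet> ?g0) (Add ?f0 ?f1 \<bullet> ?g1))"
    by (intro Add_cong eqv.sym[OF eqv.Comp_Add_left]) (use * in simp_all)
  also have "eqv P \<dots> (Add ?f0 ?f1 \<bullet> Add ?g0 ?g1)"
    by (intro eqv.sym[OF eqv.Comp_Add_right]) (use * in simp_all)
  also have "eqv P \<dots> (f \<bullet> g)"
    by (intro Comp_cong Comp.IH *) (use * in simp_all)
  finally show ?case by simp
next
  case (Tens f g)
  then have *: "wt P f" "wt P g" by auto
  let ?f0 = "proj P False f" and ?f1 = "proj P True f"
    and ?g0 = "proj P False g" and ?g1 = "proj P True g"
  have "eqv P (Add (Add (?f0 \<otimes> ?g0) (?f1 \<otimes> ?g1)) (Add (?f1 \<otimes> ?g0) (?f0 \<otimes> ?g1)))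
     (Add (Add (?f0 \<otimes> ?g0) (?f1 \<otimes> ?g0)) (Add (?f1 \<otimes> ?g1) (?f0 \<otimes> ?g1)))"
    by (rule Add4) (use * in \<open>auto simp: arrow_def\<close>)
  also have "eqv P \<dots> (Add (Add (?f0 \<otimes> ?g0) (?f1 \<otimes> ?g0)) (Add (?f0 \<otimes> ?g1) (?f1 \<otimes> ?g1)))"
    by (intro Add_cong eqv.refl eqv.Add_commute) (use * in simp_all)
  also have "eqv P \<dots> (Add (Add ?f0 ?f1 \<otimes> ?g0) (Add ?f0 ?f1 \<otimes> ?g1))"
    by (intro Add_cong eqv.sym[OF eqv.Tens_Add_left]) (use * in simp_all)
  also have "eqv P \<dots> (Add ?f0 ?f1 \<otimes> Add ?g0 ?g1)"
    by (intro eqv.sym[OF eqv.Tens_Add_right]) (use * in simp_all)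
  also have "eqv P \<dots> (f \<otimes> g)"
    by (intro Tens_cong Tens.IH *)
  finally show ?case by simp
qed

lemma proj_Tens_left:
  assumes "wt P f" "wt P g" "homog P q g"
  shows "eqv P (proj P p (f \<otimes> g)) (proj P (p \<noteq> q) f \<otimes> g)"
proof -
  let ?Z = "Zero (src P f @ src P g) (tgt P f @ tgt P g)"
  have z: "eqv P (proj P r f \<otimes> proj P (\<not> q) g) ?Z" for r
    by (rule tr[OF Tens_cong[OF eqv.refl proj_other[OF assms(3)]] Tens_Zero])
      (use assms in \<open>auto simp: arrow_def\<close>)
  have n: "eqv P (proj P r f \<otimes> proj P q g) (proj P r f \<otimes> g)" for r
    by (rule Tens_cong[OF eqv.refl proj_same]) (use assms in auto)
  have a: "arrow P (src P f @ src P g) (tgt P f @ tgt P g) (proj P r f \<otimes> g)" for r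
    using assms by (simp add: arrow_def)
  show ?thesis
    using z n a by (cases q) (auto intro: eqv_zero_left eqv_zero_right)
qed

lemma proj_Tens_right:
  assumes "wt P f" "wt P g" "homog P q f"
  shows "eqv P (proj P p (f \<otimes> g)) (f \<otimes> proj P (p \<noteq> q) g)"
proof -
  let ?Z = "Zero (src P f @ src P g) (tgt P f @ tgt P g)"
  have z: "r \<noteq> q \<Longrightarrow> eqv P (proj P r f \<otimes> proj P s g) ?Z" for r s
    by (rule tr[OF Tens_cong[OF proj_other[OF assms(3)] eqv.refl] Zero_Tens])
      (use assms in \<open>auto simp: arrow_def\<close>)
  have n: "eqv P (proj P q f \<otimes> proj P r g) (f \<otimes> proj P r g)" for r
    by (rule Tens_cong[OF proj_same eqv.refl]) (use assms in auto)
  have a: "arrow P (src P f @ src P g) (tgt P f @ tgt P g) (f \<otimes> proj P r g)" for r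
    using assms by (simp add: arrow_def)
  show ?thesis
    using z[of False] z[of True] n a by (cases q; cases p) (auto intro: eqv_zero_left eqv_zero_right)
qed

lemma proj_Comp_right:
  assumes "wt P (f \<bullet> g)" "homog P q g"
  shows "eqv P (proj P p (f \<bullet> g)) (proj P (p \<noteq> q) f \<bullet> g)"
proof -
  let ?Z = "Zero (src P g) (tgt P f)"
  have z: "eqv P (proj P r f \<bullet> proj P (\<not> q) g) ?Z" for r
    by (rule tr[OF Comp_cong[OF eqv.refl proj_other[OF assms(2)]] Comp_Zero])
      (use assms in \<open>auto simp: arrow_def\<close>)
  have n: "eqv P (proj P r f \<bullet> proj P q g) (proj P r f \<bullet> g)" for r
    by (rule Comp_cong[OF eqv.refl proj_same]) (use assms in auto)
  have a: "arrow P (src P g) (tgt P f) (proj P r f \<bullet> g)" for r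
    using assms by (simp add: arrow_def)
  show ?thesis
    using z n a by (cases q) (auto intro: eqv_zero_left eqv_zero_right)
qed

lemma proj_Comp_left:
  assumes "wt P (f \<bullet> g)" "homog P q f"
  shows "eqv P (proj P p (f \<bullet> g)) (f \<bullet> proj P (p \<noteq> q) g)"
proof -
  let ?Z = "Zero (src P g) (tgt P f)"
  have z: "r \<noteq> q \<Longrightarrow> eqv P (proj P r f \<bullet> proj P s g) ?Z" for r s
    by (rule tr[OF Comp_cong[OF proj_other[OF assms(2)] eqv.refl] Zero_Comp])
      (use assms in \<open>auto simp: arrow_def\<close>)
  have n: "eqv P (proj P q f \<bullet> proj P r g) (f \<bullet> proj P r g)" for r
    by (rule Comp_cong[OF proj_same eqv.refl]) (use assms in auto)
  have a: "arrow P (src P g) (tgt P f) (f \<bullet> proj P r g)" for r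
    using assms by (simp add: arrow_def)
  show ?thesis
    using z[of False] z[of True] n a by (cases q; cases p) (auto intro: eqv_zero_left eqv_zero_right)
qed

lemma eqv_proj: "eqv P f g \<Longrightarrow> eqv P (proj P p f) (proj P p g)"
proof (induction arbitrary: p rule: eqv.induct)
  case (rel l r)
  then obtain q where q: "homog P q l" "homog P q r" "wt P l" "wt P r"
    "src P l = src P r" "tgt P l = tgt P r"
    using P by (fastforce simp: admissible_def)
  show ?case
  proof (cases "p = q")
    case True
    have "eqv P (proj P p l) l" using True q by (auto intro: proj_same)
    also have "eqv P l r" using rel by (rule eqv.rel)
    also have "eqv P r (proj P p r)" using True q by (auto intro: eqv.sym proj_same)
    finally show ?thesis .
  next
    case False
    show ?thesis
      using proj_other[OF q(1,3) False] proj_other[OF q(2,4) False] q(5,6)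
      by (auto intro: tr eqv.sym)
  qed
next
  case (cong_Add f f' g g')
  then show ?case by (auto intro: Add_cong)
next
  case (cong_Comp f f' g g')
  then show ?case by (auto intro!: Add_cong Comp_cong)
next
  case (cong_Tens f f' g g')
  then show ?case by (auto intro!: Add_cong Tens_cong dest!: eqv_typed)
next
  case (Scale_add f g a)
  then show ?case by (auto intro: eqv.Scale_add)
next
  case (Comp_assoc f g h)
  then have *: "wt P f" "wt P g" "wt P h" "src P f = tgt P g" "src P g = tgt P h" by auto
  let ?f = "\<lambda>p. proj P p f" and ?g = "\<lambda>p. proj P p g" and ?h = "\<lambda>p. proj P p h"
  have "eqv P (Add (Add (?f p \<bullet> ?g False) (?f (\<not> p) \<bullet> ?g True) \<bullet> ?h False)
                   (Add (?f (\<not> p) \<bullet> ?g False) (?f p \<bullet> ?g True) \<bullet> ?h True))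
              (Add (Add (?f p \<bullet> ?g False \<bullet> ?h False) (?f (\<not> p) \<bullet> ?g True \<bullet> ?h False))
                   (Add (?f (\<not> p) \<bullet> ?g False \<bullet> ?h True) (?f p \<bullet> ?g True \<bullet> ?h True)))"
    by (intro Add_cong eqv.Comp_Add_left) (use * in simp_all)
  also have "eqv P \<dots>
              (Add (Add (?f p \<bullet> (?g False \<bullet> ?h False)) (?f (\<not> p) \<bullet> (?g True \<bullet> ?h False)))
                   (Add (?f p \<bullet> (?g True \<bullet> ?h True)) (?f (\<not> p) \<bullet> (?g False \<bullet> ?h True))))"
    by (rule Add_cong[OF _ tr[OF eqv.Add_commute]]; (intro Add_cong eqv.Comp_assoc)?)
      (use * in simp_all)
  also have "eqv P \<dots>
              (Add (Add (?f p \<bullet> (?g False \<bullet> ?h False)) (?f p \<bullet> (?g True \<bullet> ?h True)))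
                   (Add (?f (\<not> p) \<bullet> (?g True \<bullet> ?h False)) (?f (\<not> p) \<bullet> (?g False \<bullet> ?h True))))"
    by (rule Add4) (use * in \<open>simp_all add: arrow_def\<close>)
  also have "eqv P \<dots>
              (Add (?f p \<bullet> (Add (?g False \<bullet> ?h False) (?g True \<bullet> ?h True)))
                   (?f (\<not> p) \<bullet> Add (?g True \<bullet> ?h False) (?g False \<bullet> ?h True)))"
    by (intro Add_cong eqv.sym[OF eqv.Comp_Add_right]) (use * in simp_all)
  finally show ?case by simp
next
  case (Tens_assoc f g h)
  then have *: "wt P f" "wt P g" "wt P h" by auto
  let ?f = "\<lambda>p. proj P p f" and ?g = "\<lambda>p. proj P p g" and ?h = "\<lambda>p. proj P p h"
  have "eqv P (Add (Add (?f p \<otimes> ?g False) (?f (\<not> p) \<otimes> ?g True) \<otimes> ?h False)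
                   (Add (?f (\<not> p) \<otimes> ?g False) (?f p \<otimes> ?g True) \<otimes> ?h True))
              (Add (Add (?f p \<otimes> ?g False \<otimes> ?h False) (?f (\<not> p) \<otimes> ?g True \<otimes> ?h False))
                   (Add (?f (\<not> p) \<otimes> ?g False \<otimes> ?h True) (?f p \<otimes> ?g True \<otimes> ?h True)))"
    by (intro Add_cong eqv.Tens_Add_left) (use * in simp_all)
  also have "eqv P \<dots>
              (Add (Add (?f p \<otimes> (?g False \<otimes> ?h False)) (?f (\<not> p) \<otimes> (?g True \<otimes> ?h False)))
                   (Add (?f p \<otimes> (?g True \<otimes> ?h True)) (?f (\<not> p) \<otimes> (?g False \<otimes> ?h True))))"
    by (rule Add_cong[OF _ tr[OF eqv.Add_commute]]; (intro Add_cong eqv.Tens_assoc)?)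
      (use * in simp_all)
  also have "eqv P \<dots>
              (Add (Add (?f p \<otimes> (?g False \<otimes> ?h False)) (?f p \<otimes> (?g True \<otimes> ?h True)))
                   (Add (?f (\<not> p) \<otimes> (?g True \<otimes> ?h False)) (?f (\<not> p) \<otimes> (?g False \<otimes> ?h True))))"
    by (rule Add4) (use * in \<open>simp_all add: arrow_def\<close>)
  also have "eqv P \<dots>
              (Add (?f p \<otimes> (Add (?g False \<otimes> ?h False) (?g True \<otimes> ?h True)))
                   (?f (\<not> p) \<otimes> Add (?g True \<otimes> ?h False) (?g False \<otimes> ?h True)))"
    by (intro Add_cong eqv.sym[OF eqv.Tens_Add_right]) (use * in simp_all)
  finally show ?case by simp
next
  case (Id_Comp X Y f)
  then have "eqv P (proj P p (Id Y \<bullet> f)) (Id Y \<bullet> proj P (p \<noteq> False) f)"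
    by (intro proj_Comp_left homog.intros) (auto simp: arrow_def)
  also have "eqv P \<dots> (proj P (p \<noteq> False) f)"
    by (rule eqv.Id_Comp[of _ X]) (use Id_Comp in \<open>simp add: arrow_def\<close>)
  finally show ?case by simp
next
  case (Comp_Id X Y f)
  then have "eqv P (proj P p (f \<bullet> Id X)) (proj P (p \<noteq> False) f \<bullet> Id X)"
    by (intro proj_Comp_right homog.intros) (auto simp: arrow_def)
  also have "eqv P \<dots> (proj P (p \<noteq> False) f)"
    by (rule eqv.Comp_Id[of _ _ Y]) (use Comp_Id in \<open>simp add: arrow_def\<close>)
  finally show ?case by simp
next
  case (Unit_Tens f)
  then have "eqv P (proj P p (Id [] \<otimes> f)) (Id [] \<otimes> proj P (p \<noteq> False) f)"
    by (intro proj_Tens_right homog.intros) auto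
  also have "eqv P \<dots> (proj P (p \<noteq> False) f)"
    by (rule eqv.Unit_Tens) (use Unit_Tens in simp)
  finally show ?case by simp
next
  case (Tens_Unit f)
  then have "eqv P (proj P p (f \<otimes> Id [])) (proj P (p \<noteq> False) f \<otimes> Id [])"
    by (intro proj_Tens_left homog.intros) auto
  also have "eqv P \<dots> (proj P (p \<noteq> False) f)"
    by (rule eqv.Tens_Unit) (use Tens_Unit in simp)
  finally show ?case by simp
next
  case (Tens_Id X Y)
  have "eqv P (proj P p (Id X \<otimes> Id Y)) (Id X \<otimes> proj P (p \<noteq> False) (Id Y))"
    by (intro proj_Tens_right homog.intros) auto
  also have "eqv P \<dots> (proj P p (Id (X @ Y)))"
    by (auto intro: eqv.Tens_Id Tens_Zero simp: arrow_def)
  finally show ?case .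
next
  case (Comp_Add_left f f' g)
  then show ?case
    by (auto intro!: tr[OF Add_cong[OF eqv.Comp_Add_left eqv.Comp_Add_left]
          Add4[where X = "src P g" and Y = "tgt P f"]] simp: arrow_def)
next
  case (Comp_Add_right f g g')
  then show ?case
    by (auto intro!: tr[OF Add_cong[OF eqv.Comp_Add_right eqv.Comp_Add_right]
          Add4[where X = "src P g" and Y = "tgt P f"]] simp: arrow_def)
next
  case (Tens_Add_left f f' g)
  then show ?case
    by (auto intro!: tr[OF Add_cong[OF eqv.Tens_Add_left eqv.Tens_Add_left]
          Add4[where X = "src P f @ src P g" and Y = "tgt P f @ tgt P g"]] simp: arrow_def)
next
  case (Tens_Add_right f g g')
  then show ?case
    by (auto intro!: tr[OF Add_cong[OF eqv.Tens_Add_right eqv.Tens_Add_right]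
          Add4[where X = "src P f @ src P g" and Y = "tgt P f @ tgt P g"]] simp: arrow_def)
next
  case (Comp_Scale_left f g a)
  then show ?case
    by (auto intro!: tr[OF Add_cong[OF eqv.Comp_Scale_left eqv.Comp_Scale_left] eqv.sym[OF eqv.Scale_add]])
next
  case (Comp_Scale_right f g a)
  then show ?case
    by (auto intro!: tr[OF Add_cong[OF eqv.Comp_Scale_right eqv.Comp_Scale_right] eqv.sym[OF eqv.Scale_add]])
next
  case (Tens_Scale_left f g a)
  then show ?case
    by (auto intro!: tr[OF Add_cong[OF eqv.Tens_Scale_left eqv.Tens_Scale_left] eqv.sym[OF eqv.Scale_add]])
next
  case (Tens_Scale_right f g a)
  then show ?case
    by (auto intro!: tr[OF Add_cong[OF eqv.Tens_Scale_right eqv.Tens_Scale_right] eqv.sym[OF eqv.Scale_add]])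
next
  case (Interchange f' f g g' a b)
  then have *: "wt P f" "wt P f'" "wt P g" "wt P g'" "src P f' = tgt P f" "src P g = tgt P g'"
    by auto
  note h = Interchange(3,4)
  let ?s = "koszul_sign a b"
  let ?A = "\<lambda>r. (proj P (r \<noteq> b) f' \<bullet> f) \<otimes> (g \<bullet> proj P (p \<noteq> (r \<noteq> a)) g')"
  have B: "eqv P (proj P r (f' \<otimes> g) \<bullet> proj P s (f \<otimes> g')) (Scale ?s (?A r))" if "p = (r \<noteq> s)" for r s
  proof -
    have "eqv P (proj P r (f' \<otimes> g) \<bullet> proj P s (f \<otimes> g'))
        ((proj P (r \<noteq> b) f' \<otimes> g) \<bullet> (f \<otimes> proj P (s \<noteq> a) g'))"
      by (intro Comp_cong proj_Tens_left proj_Tens_right h *) (use * in simp)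
    also have "eqv P \<dots> (Scale ?s ((proj P (r \<noteq> b) f' \<bullet> f) \<otimes> (g \<bullet> proj P (s \<noteq> a) g')))"
      by (intro eqv.Interchange h) (use * in simp_all)
    finally show ?thesis using that by (cases r; cases s; cases a; simp)
  qed
  have C: "eqv P (?A r) (proj P (r \<noteq> (a \<noteq> b)) (f' \<bullet> f) \<otimes> proj P (p \<noteq> (r \<noteq> (a \<noteq> b))) (g \<bullet> g'))" for r
  proof (rule eqv.sym, rule Tens_cong)
    have "(r \<noteq> b) = ((r \<noteq> (a \<noteq> b)) \<noteq> a)" by auto
    then show "eqv P (proj P (r \<noteq> (a \<noteq> b)) (f' \<bullet> f)) (proj P (r \<noteq> b) f' \<bullet> f)"
      using proj_Comp_right[OF _ h(1), of f' "r \<noteq> (a \<noteq> b)"] * by simp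
    have "(p \<noteq> (r \<noteq> a)) = ((p \<noteq> (r \<noteq> (a \<noteq> b))) \<noteq> b)" by auto
    then show "eqv P (proj P (p \<noteq> (r \<noteq> (a \<noteq> b))) (g \<bullet> g')) (g \<bullet> proj P (p \<noteq> (r \<noteq> a)) g')"
      using proj_Comp_left[OF _ h(2), of g' "p \<noteq> (r \<noteq> (a \<noteq> b))"] * by simp
  qed
  have "eqv P (proj P p ((f' \<otimes> g) \<bullet> (f \<otimes> g'))) (Add (Scale ?s (?A p)) (Scale ?s (?A (\<not> p))))"
    unfolding proj.simps(6) by (intro Add_cong B) (use * in simp_all)
  also have "eqv P \<dots> (Scale ?s (Add (?A p) (?A (\<not> p))))"
    by (intro eqv.sym[OF eqv.Scale_add]) (use * in simp)
  also have "eqv P \<dots> (Scale ?s (proj P p ((f' \<bullet> f) \<otimes> (g \<bullet> g'))))"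
  proof (rule Scale_cong)
    let ?T = "\<lambda>r. proj P r (f' \<bullet> f) \<otimes> proj P (p \<noteq> r) (g \<bullet> g')"
    have D: "eqv P (Add (?A p) (?A (\<not> p))) (Add (?T (p \<noteq> (a \<noteq> b))) (?T ((\<not> p) \<noteq> (a \<noteq> b))))"
      by (intro Add_cong C) (use * in simp_all)
    have E: "eqv P (Add (?T (\<not> p)) (?T p)) (Add (?T p) (?T (\<not> p)))"
      by (rule eqv.Add_commute) (use * in simp)
    have "proj P p ((f' \<bullet> f) \<otimes> (g \<bullet> g')) = Add (?T p) (?T (\<not> p))"
      unfolding proj.simps(7) by simp
    then show "eqv P (Add (?A p) (?A (\<not> p))) (proj P p ((f' \<bullet> f) \<otimes> (g \<bullet> g')))"
      using D tr[OF _ E] by (cases "a = b") (simp_all del: proj.simps)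
  qed
  finally show ?case by (simp only: proj.simps(5))
qed (auto intro: eqv.intros simp: arrow_def)

lemma cls_eq: "wt P f \<Longrightarrow> cls P f = cls P g \<longleftrightarrow> eqv P f g"
  unfolding cls_def using eqv.refl[of P f] eqv.sym eqv.trans by blast

lemma cls_eqI: "eqv P f g \<Longrightarrow> cls P f = cls P g"
  using cls_eq eqv_typed by blast

lemma add_cls: "wt P (Add f g) \<Longrightarrow> add (presented P) (cls P f) (cls P g) = cls P (Add f g)"
  by (auto simp: presented_def cls_def dest: eqv_typed
    intro: tr[OF eqv.cong_Add] intro!: exI[of _ f] exI[of _ g] eqv.refl)

lemma scale_cls: "wt P f \<Longrightarrow> scale (presented P) a (cls P f) = cls P (Scale a f)"
  by (auto simp: presented_def cls_def intro: tr[OF Scale_cong] intro!: exI[of _ f] eqv.refl)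

lemma comp_cls: "wt P (f \<bullet> g) \<Longrightarrow> comp (presented P) (cls P f) (cls P g) = cls P (f \<bullet> g)"
  by (auto simp: presented_def cls_def dest: eqv_typed
    intro: tr[OF eqv.cong_Comp] intro!: exI[of _ f] exI[of _ g] eqv.refl)

lemma tensor_cls: "wt P (f \<otimes> g) \<Longrightarrow> tensor (presented P) (cls P f) (cls P g) = cls P (f \<otimes> g)"
  by (auto simp: presented_def cls_def dest: eqv_typed
    intro: tr[OF eqv.cong_Tens] intro!: exI[of _ f] exI[of _ g] eqv.refl)

lemma presented_simps:
  "hom (presented P) X Y = cls P ` {t. arrow P X Y t}"
  "part (presented P) X Y p = cls P ` {t. arrow P X Y t \<and> homog P p t}"
  "zero (presented P) X Y = cls P (Zero X Y)"
  "ident (presented P) X = cls P (Id X)"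
  "unit (presented P) = []"
  "tensor_ob (presented P) X Y = X @ Y"
  by (simp_all add: presented_def)

lemmas eqv_axioms =
  eqv.Add_assoc eqv.Add_commute eqv.Add_zero eqv.Add_neg eqv.Scale_add eqv.Scale_plus
  eqv.Scale_Scale eqv.Scale_one eqv.Comp_assoc eqv.Id_Comp eqv.Comp_Id eqv.Comp_Add_left
  eqv.Comp_Add_right eqv.Comp_Scale_left eqv.Comp_Scale_right eqv.Tens_assoc eqv.Unit_Tens
  eqv.Tens_Unit eqv.Tens_Id eqv.Tens_Add_left eqv.Tens_Add_right eqv.Tens_Scale_left
  eqv.Tens_Scale_right eqv.Interchange

lemma presented_direct_sum:
  assumes "A \<in> hom (presented P) X Y"
  shows "\<exists>!u. fst u \<in> part (presented P) X Y False \<and> snd u \<in> part (presented P) X Y True \<and>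
    A = add (presented P) (fst u) (snd u)"
proof -
  obtain t where t: "arrow P X Y t" "A = cls P t"
    using assms by (auto simp: presented_simps)
  show ?thesis
  proof (rule ex1I[of _ "(cls P (proj P False t), cls P (proj P True t))"], goal_cases)
    case 1
    have "cls P (Add (proj P False t) (proj P True t)) = cls P t"
      using t by (intro cls_eqI eqv_proj_sum) (auto simp: arrow_def)
    with t show ?case
      by (auto simp: presented_simps arrow_def add_cls homog_proj)
  next
    case (2 u)
    then obtain f g where fg: "arrow P X Y f" "homog P False f" "arrow P X Y g" "homog P True g"
      "u = (cls P f, cls P g)" "cls P t = add (presented P) (cls P f) (cls P g)"
      using t by (cases u) (auto simp: presented_simps)
    then have "cls P t = cls P (Add f g)"
      by (simp add: add_cls arrow_def)
    then have e: "eqv P t (Add f g)"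
      using t by (simp add: cls_eq arrow_def)
    have "eqv P (proj P False t) (Add (proj P False f) (proj P False g))"
      using eqv_proj[OF e, of False] by simp
    also have "eqv P \<dots> f"
      by (rule eqv_zero_right[OF proj_other[OF fg(4)] proj_same[OF fg(2)]])
        (use fg in \<open>auto simp: arrow_def\<close>)
    finally have f: "eqv P (proj P False t) f" .
    have "eqv P (proj P True t) (Add (proj P True f) (proj P True g))"
      using eqv_proj[OF e, of True] by simp
    also have "eqv P \<dots> g"
      by (rule eqv_zero_left[OF proj_other[OF fg(2)] proj_same[OF fg(4)]])
        (use fg in \<open>auto simp: arrow_def\<close>)
    finally have g: "eqv P (proj P True t) g" .
    show ?case using cls_eqI[OF f] cls_eqI[OF g] fg(5) by simp
  qed
qed

theorem presented_strict_monoidal_supercategory: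
  "strict_monoidal_supercategory (presented P)"
proof
  fix X Y p
  show "part (presented P) X Y p \<subseteq> hom (presented P) X Y"
    by (auto simp: presented_simps)
next
  fix f X Y
  assume "f \<in> hom (presented P) X Y"
  then show "\<exists>!u. fst u \<in> part (presented P) X Y False \<and> snd u \<in> part (presented P) X Y True \<and>
    f = add (presented P) (fst u) (snd u)"
    by (rule presented_direct_sum)
qed (auto simp: presented_simps arrow_def add_cls scale_cls comp_cls tensor_cls cls_eq
      del: subset_antisym intro!: imageI eqv_axioms intro: homog.intros homog_Comp homog_Tens)

end

subsection \<open>Superfunctors induced by maps of generators\<close>

context
  fixes P :: "('k::comm_ring_1, 'o, 'g) presentation"
    and P' :: "('k, 'o, 'h) presentation"
    and \<sigma> :: "'g \<Rightarrow> 'h"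
  assumes P: "admissible P" and P': "admissible P'"
    and gsrc: "\<And>g. gsrc P' (\<sigma> g) = gsrc P g"
    and gtgt: "\<And>g. gtgt P' (\<sigma> g) = gtgt P g"
    and gpar: "\<And>g. gpar P' (\<sigma> g) = gpar P g"
    and rels: "\<And>l r. (l, r) \<in> rels P \<Longrightarrow> eqv P' (rename \<sigma> l) (rename \<sigma> r)"
begin

lemma src_rename [simp]: "src P' (rename \<sigma> t) = src P t"
  by (induction t) (auto simp: gsrc)

lemma tgt_rename [simp]: "tgt P' (rename \<sigma> t) = tgt P t"
  by (induction t) (auto simp: gtgt)

lemma wt_rename [simp]: "wt P' (rename \<sigma> t) = wt P t"
  by (induction t) auto

lemma arrow_rename [simp]: "arrow P' X Y (rename \<sigma> t) = arrow P X Y t"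
  by (simp add: arrow_def)

lemma homog_rename: "homog P p t \<Longrightarrow> homog P' p (rename \<sigma> t)"
proof (induction rule: homog.induct)
  case (1 g)
  then show ?case using homog.intros(1)[of P' "\<sigma> g"] by (simp add: gpar)
qed (auto intro: homog.intros homog_Comp homog_Tens)

lemma eqv_rename: "eqv P f g \<Longrightarrow> eqv P' (rename \<sigma> f) (rename \<sigma> g)"
proof (induction rule: eqv.induct)
  case (Interchange f' f g g' p q)
  then show ?case by (auto intro!: eqv.Interchange homog_rename)
next
  case (trans f g h)
  then show ?case by (blast intro: eqv.trans)
qed (auto intro: rels eqv.intros)

lemma induced_cls: "wt P f \<Longrightarrow> induced P' \<sigma> (cls P f) = cls P' (rename \<sigma> f)"
  by (auto simp: induced_def cls_def
      intro: eqv.trans eqv_rename intro!: exI[of _ f] eqv.refl)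

theorem induced_superfunctor:
  "strict_monoidal_superfunctor (presented P) (presented P') (\<lambda>X. X) (induced P' \<sigma>)"
  unfolding strict_monoidal_superfunctor_def
  by (auto simp: presented_simps[OF P] presented_simps[OF P'] arrow_def induced_cls homog_rename
      add_cls[OF P] scale_cls[OF P] comp_cls[OF P] tensor_cls[OF P]
      add_cls[OF P'] scale_cls[OF P'] comp_cls[OF P'] tensor_cls[OF P'])

end


section \<open>The quantum isomeric and quantum affine isomeric supercategories\<close>

datatype ori = Up | Dn

datatype qgen = U_plus | U_minus | R_minus | Cap_L | Cup_L | C_dot

datatype aqgen = Q_gen qgen | O_dot

primrec q_src :: "qgen \<Rightarrow> ori list" where
  "q_src U_plus = [Up, Up]"
| "q_src U_minus = [Up, Up]"
| "q_src R_minus = [Up, Dn]"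
| "q_src Cap_L = [Dn, Up]"
| "q_src Cup_L = []"
| "q_src C_dot = [Up]"

primrec q_tgt :: "qgen \<Rightarrow> ori list" where
  "q_tgt U_plus = [Up, Up]"
| "q_tgt U_minus = [Up, Up]"
| "q_tgt R_minus = [Dn, Up]"
| "q_tgt Cap_L = []"
| "q_tgt Cup_L = [Up, Dn]"
| "q_tgt C_dot = [Up]"

definition q_par :: "qgen \<Rightarrow> bool" where
  "q_par g \<longleftrightarrow> g = C_dot"

abbreviation "id_up \<equiv> Id [Up]"
abbreviation "id_dn \<equiv> Id [Dn]"
abbreviation "u_plus \<equiv> Gen U_plus"
abbreviation "u_minus \<equiv> Gen U_minus"
abbreviation "r_minus \<equiv> Gen R_minus"
abbreviation "cap_L \<equiv> Gen Cap_L"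
abbreviation "cup_L \<equiv> Gen Cup_L"
abbreviation "dot_c \<equiv> Gen C_dot"

definition l_plus :: "('k, ori, qgen) trm" where
  "l_plus = (cap_L \<otimes> id_up \<otimes> id_dn) \<bullet> (id_dn \<otimes> u_plus \<otimes> id_dn) \<bullet> (id_dn \<otimes> id_up \<otimes> cup_L)"

definition cap_R :: "('k, ori, qgen) trm" where
  "cap_R = cap_L \<bullet> r_minus"

definition Q_rels :: "'k::comm_ring_1 \<Rightarrow> ('k, ori, qgen) trm rel" where
  "Q_rels z = {
     (u_minus \<bullet> u_plus, Id [Up, Up]),
     (u_plus \<bullet> u_minus, Id [Up, Up]),
     (l_plus \<bullet> r_minus, Id [Up, Dn]),
     (r_minus \<bullet> l_plus, Id [Dn, Up]),
     ((u_plus \<otimes> id_up) \<bullet> (id_up \<otimes> u_plus) \<bullet> (u_plus \<otimes> id_up), (id_up \<otimes> u_plus) \<bullet> (u_plus \<otimes> id_up) \<bullet> (id_up \<otimes> u_plus)),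
     (Add u_plus (Scale (- 1) u_minus), Scale z (Id [Up, Up])),
     (dot_c \<bullet> dot_c, Scale (- 1) id_up),
     (u_plus \<bullet> (dot_c \<otimes> id_up), (id_up \<otimes> dot_c) \<bullet> u_plus),
     (cap_R \<bullet> (dot_c \<otimes> id_dn) \<bullet> cup_L, Zero [] []),
     (cap_R \<bullet> cup_L, Zero [] []),
     ((id_up \<otimes> cap_L) \<bullet> (cup_L \<otimes> id_up), id_up),
     ((cap_L \<otimes> id_dn) \<bullet> (id_dn \<otimes> cup_L), id_dn)}"

definition Q_pres :: "'k::comm_ring_1 \<Rightarrow> ('k, ori, qgen) presentation" where
  "Q_pres z = \<lparr>gsrc = q_src, gtgt = q_tgt, gpar = q_par, rels = Q_rels z\<rparr>"

abbreviation "dot_o \<equiv> Gen O_dot"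

definition AQ_rels :: "'k::comm_ring_1 \<Rightarrow> ('k, ori, aqgen) trm rel" where
  "AQ_rels z = map_prod (rename Q_gen) (rename Q_gen) ` Q_rels z \<union> {
     (dot_o \<bullet> dot_o, Scale (- 1) id_up),
     (rename Q_gen u_plus \<bullet> (id_up \<otimes> dot_o), (dot_o \<otimes> id_up) \<bullet> rename Q_gen u_plus),
     (rename Q_gen cap_R \<bullet> (dot_o \<otimes> id_dn) \<bullet> rename Q_gen cup_L, Zero [] [])}"

definition AQ_pres :: "'k::comm_ring_1 \<Rightarrow> ('k, ori, aqgen) presentation" where
  "AQ_pres z = \<lparr>
     gsrc = case_aqgen q_src [Up],
     gtgt = case_aqgen q_tgt [Up],
     gpar = case_aqgen q_par True,
     rels = AQ_rels z\<rparr>"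

type_synonym 'k Q_mor = "('k, ori, qgen) trm set"
type_synonym 'k AQ_mor = "('k, ori, aqgen) trm set"

definition Q :: "'k::comm_ring_1 \<Rightarrow> ('k, ori list, 'k Q_mor) smcat" where
  "Q z = presented (Q_pres z)"

definition AQ :: "'k::comm_ring_1 \<Rightarrow> ('k, ori list, 'k AQ_mor) smcat" where
  "AQ z = presented (AQ_pres z)"

definition Q_to_AQ :: "'k::comm_ring_1 \<Rightarrow> 'k Q_mor \<Rightarrow> 'k AQ_mor" where
  "Q_to_AQ z = induced (AQ_pres z) Q_gen"

subsection \<open>Well-definedness of the presentations and of the superfunctor\<close>

primrec degree :: "('k, 'o, 'g) presentation \<Rightarrow> ('k, 'o, 'g) trm \<Rightarrow> bool" where
  "degree P (Gen g) = gpar P g"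
| "degree P (Id X) = False"
| "degree P (Zero X Y) = False"
| "degree P (Add f g) = degree P f"
| "degree P (Scale a f) = degree P f"
| "degree P (f \<bullet> g) = (degree P f \<noteq> degree P g)"
| "degree P (f \<otimes> g) = (degree P f \<noteq> degree P g)"

primrec balanced :: "('k, 'o, 'g) presentation \<Rightarrow> ('k, 'o, 'g) trm \<Rightarrow> bool" where
  "balanced P (Gen g) = True"
| "balanced P (Id X) = True"
| "balanced P (Zero X Y) = True"
| "balanced P (Add f g) = (balanced P f \<and> balanced P g \<and> degree P f = degree P g)"
| "balanced P (Scale a f) = balanced P f"
| "balanced P (f \<bullet> g) = (balanced P f \<and> balanced P g)"
| "balanced P (f \<otimes> g) = (balanced P f \<and> balanced P g)"

lemma homog_degree: "balanced P f \<Longrightarrow> homog P (degree P f) f"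
  by (induction f) (auto intro: homog.intros homog_Gen homog_Comp homog_Tens)

lemma admissibleI:
  assumes "\<And>l r. (l, r) \<in> rels P \<Longrightarrow>
     wt P l \<and> wt P r \<and> src P l = src P r \<and> tgt P l = tgt P r \<and> balanced P l \<and> balanced P r \<and>
     (degree P l = degree P r \<or> r = Zero (src P l) (tgt P l))"
  shows "admissible P"
  unfolding admissible_def
proof safe
  fix l r assume "(l, r) \<in> rels P"
  note a = assms[OF this]
  then have "homog P (degree P l) r"
    using homog_degree[of P r] by (auto intro: homog.intros(3))
  with a homog_degree show "\<exists>p. homog P p l \<and> homog P p r" by blast
qed (use assms in auto)

lemma admissible_Q: "admissible (Q_pres z)"
  by (rule admissibleI)
    (auto simp: Q_pres_def Q_rels_def l_plus_def cap_R_def q_par_def)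

lemma admissible_AQ: "admissible (AQ_pres z)"
  by (rule admissibleI)
    (auto simp: AQ_pres_def AQ_rels_def Q_rels_def l_plus_def cap_R_def q_par_def)

theorem strict_monoidal_supercategory_Q: "strict_monoidal_supercategory (Q z)"
  unfolding Q_def by (rule presented_strict_monoidal_supercategory[OF admissible_Q])

theorem strict_monoidal_supercategory_AQ: "strict_monoidal_supercategory (AQ z)"
  unfolding AQ_def by (rule presented_strict_monoidal_supercategory[OF admissible_AQ])

lemma AQ_extends:
  "gsrc (AQ_pres z) (Q_gen g) = gsrc (Q_pres z) g"
  "gtgt (AQ_pres z) (Q_gen g) = gtgt (Q_pres z) g"
  "gpar (AQ_pres z) (Q_gen g) = gpar (Q_pres z) g"
  "(l, r) \<in> rels (Q_pres z) \<Longrightarrow> eqv (AQ_pres z) (rename Q_gen l) (rename Q_gen r)"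
  by (force simp: AQ_pres_def Q_pres_def AQ_rels_def intro: eqv.rel)+

theorem superfunctor_Q_to_AQ:
  "strict_monoidal_superfunctor (Q z) (AQ z) (\<lambda>X. X) (Q_to_AQ z)"
  unfolding Q_def AQ_def Q_to_AQ_def
  by (rule induced_superfunctor[OF admissible_Q admissible_AQ AQ_extends])

theorem Q_to_AQ_gen:
  "Q_to_AQ z (cls (Q_pres z) (Gen g)) = cls (AQ_pres z) (Gen (Q_gen g))"
  unfolding Q_to_AQ_def
  by (subst induced_cls[OF admissible_Q admissible_AQ AQ_extends]) simp_all

text \<open>These properties determine the superfunctor.\<close>

theorem Q_to_AQ_unique:
  assumes F: "strict_monoidal_superfunctor (Q z) (AQ z) (\<lambda>X. X) F"
    and gen: "\<And>g. F (cls (Q_pres z) (Gen g)) = cls (AQ_pres z) (Gen (Q_gen g))"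
    and f: "f \<in> hom (Q z) X Y"
  shows "F f = Q_to_AQ z f"
proof -
  let ?P = "Q_pres z" and ?P' = "AQ_pres z"
  note S = presented_simps[OF admissible_Q, folded Q_def]
  note S' = presented_simps[OF admissible_AQ, folded AQ_def]
  note K = add_cls[OF admissible_Q, folded Q_def] scale_cls[OF admissible_Q, folded Q_def]
    comp_cls[OF admissible_Q, folded Q_def] tensor_cls[OF admissible_Q, folded Q_def]
  interpret Q: strict_monoidal_supercategory "Q z" by (rule strict_monoidal_supercategory_Q)
  interpret AQ: strict_monoidal_supercategory "AQ z" by (rule strict_monoidal_supercategory_AQ)
  have *: "G (add (Q z) a b) = add (AQ z) (G a) (G b)"
    "G (scale (Q z) k a) = scale (AQ z) k (G a)"
    if "strict_monoidal_superfunctor (Q z) (AQ z) (\<lambda>X. X) G"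
      "a \<in> hom (Q z) V W" "b \<in> hom (Q z) V W" for G a b k V W
    using that unfolding strict_monoidal_superfunctor_def by metis+
  have **: "G (comp (Q z) a b) = comp (AQ z) (G a) (G b)"
    if "strict_monoidal_superfunctor (Q z) (AQ z) (\<lambda>X. X) G"
      "a \<in> hom (Q z) V W" "b \<in> hom (Q z) U V" for G a b U V W
    using that unfolding strict_monoidal_superfunctor_def by metis
  have ***: "G (tensor (Q z) a b) = tensor (AQ z) (G a) (G b)"
    if "strict_monoidal_superfunctor (Q z) (AQ z) (\<lambda>X. X) G"
      "a \<in> hom (Q z) V W" "b \<in> hom (Q z) S T" for G a b S T V W
    using that unfolding strict_monoidal_superfunctor_def by metis
  have I: "G (ident (Q z) V) = ident (AQ z) V"
    if "strict_monoidal_superfunctor (Q z) (AQ z) (\<lambda>X. X) G" for G V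
    using that unfolding strict_monoidal_superfunctor_def by metis
  have Z: "G (zero (Q z) V W) = zero (AQ z) V W"
    if G: "strict_monoidal_superfunctor (Q z) (AQ z) (\<lambda>X. X) G" for G V W
  proof -
    let ?n = "scale (Q z) (- 1) (zero (Q z) V W)"
    have h: "G (zero (Q z) V W) \<in> hom (AQ z) V W"
      using G[unfolded strict_monoidal_superfunctor_def, THEN conjunct1] Q.zero_hom by blast
    have "zero (Q z) V W = add (Q z) (zero (Q z) V W) ?n"
      by (rule Q.add_neg[OF Q.zero_hom, symmetric])
    then have "G (zero (Q z) V W) = add (AQ z) (G (zero (Q z) V W)) (G ?n)"
      using *(1)[OF G Q.zero_hom Q.scale_hom[OF Q.zero_hom]] by metis
    also have "G ?n = scale (AQ z) (- 1) (G (zero (Q z) V W))"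
      by (rule *(2)[OF G Q.zero_hom Q.zero_hom])
    also have "add (AQ z) (G (zero (Q z) V W)) \<dots> = zero (AQ z) V W"
      by (rule AQ.add_neg[OF h])
    finally show ?thesis .
  qed
  have "wt ?P t \<Longrightarrow> F (cls ?P t) = Q_to_AQ z (cls ?P t)" for t
  proof (induction t)
    case (Gen g)
    then show ?case by (simp add: gen Q_to_AQ_gen)
  next
    case (Id V)
    then show ?case using I[OF F, of V] I[OF superfunctor_Q_to_AQ, of V] by (simp add: S)
  next
    case (Zero V W)
    then show ?case using Z[OF F, of V W] Z[OF superfunctor_Q_to_AQ, of V W] by (simp add: S)
  next
    case (Add a b)
    then show ?case
      using *(1)[OF F, of "cls ?P a" "src ?P a" "tgt ?P a" "cls ?P b"]
        *(1)[OF superfunctor_Q_to_AQ, of "cls ?P a" "src ?P a" "tgt ?P a" "cls ?P b"]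
      by (simp add: K(1)[symmetric] S arrow_def)
  next
    case (Scale k a)
    then show ?case
      using *(2)[OF F, of "cls ?P a" "src ?P a" "tgt ?P a" "cls ?P a" k]
        *(2)[OF superfunctor_Q_to_AQ, of "cls ?P a" "src ?P a" "tgt ?P a" "cls ?P a" k]
      by (simp add: K(2)[symmetric] S arrow_def)
  next
    case (Comp a b)
    then show ?case
      using **[OF F, of "cls ?P a" "src ?P a" "tgt ?P a" "cls ?P b" "src ?P b"]
        **[OF superfunctor_Q_to_AQ, of "cls ?P a" "src ?P a" "tgt ?P a" "cls ?P b" "src ?P b"]
      by (simp add: K(3)[symmetric] S arrow_def)
  next
    case (Tens a b)
    then show ?case
      using ***[OF F, of "cls ?P a" "src ?P a" "tgt ?P a" "cls ?P b" "src ?P b" "tgt ?P b"]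
        ***[OF superfunctor_Q_to_AQ, of "cls ?P a" "src ?P a" "tgt ?P a" "cls ?P b" "src ?P b" "tgt ?P b"]
      by (simp add: K(4)[symmetric] S arrow_def)
  qed
  with f show ?thesis by (auto simp: S arrow_def)
qed

end

(* The affine supercategory acts on Q: an object A acts by tensoring with A on the left, a morphism
   f of Q by tensoring with f, and the affine dot acts on Up X by conjugating the dot c on the
   right-hand strand of X Up with a half-braiding Up X -> X Up, made of u^- and
   r^+ = r^- + z r^- cup_L cap_L r^-. Evaluating at X = 1 recovers every morphism of Q from its image,
   so the superfunctor Q -> AQ is faithful.

   The half-braiding is natural, so the only delicate relation is the vanishing of the bubble that
   carries an affine dot next to X: the bubble is slid through X to the right, where it becomes the
   vanishing bubble of Q that carries c. *)

theory Submission
  imports Defs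
begin

section \<open>Equational reasoning in a presented supercategory\<close>

text \<open>Sending o to c does not directly give a monoidal left inverse: the affine relation asks
  for u^+(1 \<otimes> o) = (o \<otimes> 1)u^+, whereas the skein relation gives u^+(1 \<otimes> c) -
  (c \<otimes> 1)u^+ = z(1 \<otimes> c - c \<otimes> 1). Letting o act in a way that depends on X
  removes the conflict. The relation then says that o on Up Up X is u^+(1 \<otimes> o)u^-, which can
  serve as a definition and pushes c to the far right. Hence upward strands are crossed by u^-, and
  c passes through u^- without an error term in the direction needed. Naturality in cup_L leaves no
  choice for downward strands: the crossing must invert the mate l^- of u^-. The presentation makes
  r^- inverse to l^+ = l^- + z cup_L cap_L instead. Correcting r^- for the difference produces z r^-
  cup_L cap_L r^-, and the series stops there because cap_R cup_L = 0.\<close>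

text \<open>
  Ill-typed terms have the empty class, and a composite of classes that do not match is empty. So
  associativity of composition holds for all sets of terms, and the typing conditions of the
  other laws become rewriting problems once domain and codomain are functions of the class.
\<close>

locale admissible_presentation =
  fixes P :: "('k::comm_ring_1, 'o, 'g) presentation"
  assumes adm: "admissible P"
begin

sublocale smc: strict_monoidal_supercategory "presented P"
  by (rule presented_strict_monoidal_supercategory[OF adm])

abbreviation comp_mor (infixr \<open>\<cdot>\<close> 70) where "x \<cdot> y \<equiv> comp (presented P) x y"
abbreviation tens_mor (infixr \<open>\<parallel>\<close> 75) where "x \<parallel> y \<equiv> tensor (presented P) x y"
abbreviation add_mor (infixl \<open>\<boxplus>\<close> 65) where "x \<boxplus> y \<equiv> add (presented P) x y"
abbreviation scale_mor (infixr \<open>\<star>\<close> 68) where "a \<star> x \<equiv> scale (presented P) a x"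
abbreviation idt (\<open>\<iota>\<close>) where "\<iota> X \<equiv> cls P (Id X)"
abbreviation nul (\<open>\<zeta>\<close>) where "\<zeta> X Y \<equiv> cls P (Zero X Y)"

definition mor where "mor x \<longleftrightarrow> (\<exists>t. wt P t \<and> x = cls P t)"
definition dm where "dm x = src P (SOME t. t \<in> x)"
definition cd where "cd x = tgt P (SOME t. t \<in> x)"
text \<open>A relation rather than a function of the class, because a zero morphism is homogeneous
  of both parities.\<close>

definition has_parity where "has_parity p x \<longleftrightarrow> (\<exists>t. wt P t \<and> homog P p t \<and> x = cls P t)"
definition wh where "wh A x B = \<iota> A \<parallel> x \<parallel> \<iota> B"

section \<open>Operations on classes and their typing\<close>

lemma cls_empty: "\<not> wt P t \<Longrightarrow> cls P t = {}"
  using eqv_typed[OF adm] by (auto simp: cls_def)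

lemma cls_self: "wt P t \<Longrightarrow> t \<in> cls P t"
  by (simp add: cls_def eqv.refl)

lemma in_cls: "s \<in> cls P t \<Longrightarrow> wt P s \<and> wt P t \<and> src P s = src P t \<and> tgt P s = tgt P t"
  using eqv_typed[OF adm] by (fastforce simp: cls_def)

lemma cls_Comp: "cls P (f \<bullet> g) = cls P f \<cdot> cls P g"
proof (cases "wt P (f \<bullet> g)")
  case False
  then have "\<not> wt P (f' \<bullet> g')" if "f' \<in> cls P f" "g' \<in> cls P g" for f' g'
    using in_cls[OF that(1)] in_cls[OF that(2)] by auto
  with False show ?thesis by (auto simp: presented_def cls_empty)
qed (simp add: comp_cls[OF adm])

lemma cls_Tens: "cls P (f \<otimes> g) = cls P f \<parallel> cls P g"
proof (cases "wt P (f \<otimes> g)")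
  case False
  then show ?thesis by (auto simp: presented_def cls_empty)
qed (simp add: tensor_cls[OF adm])

lemma cls_Add: "wt P (Add f g) \<Longrightarrow> cls P (Add f g) = cls P f \<boxplus> cls P g"
  by (simp add: add_cls[OF adm])

lemma cls_Scale: "cls P (Scale a f) = a \<star> cls P f"
proof (cases "wt P f")
  case False
  then show ?thesis by (auto simp: presented_def cls_empty)
qed (simp add: scale_cls[OF adm])

lemma mor_cls [simp]: "wt P t \<Longrightarrow> mor (cls P t)"
  by (auto simp: mor_def)

lemma dm_cls [simp]: "wt P t \<Longrightarrow> dm (cls P t) = src P t"
  unfolding dm_def using someI[of "\<lambda>s. s \<in> cls P t" t] in_cls cls_self by blast

lemma cd_cls [simp]: "wt P t \<Longrightarrow> cd (cls P t) = tgt P t"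
  unfolding cd_def using someI[of "\<lambda>s. s \<in> cls P t" t] in_cls cls_self by blast

lemma hom_iff: "x \<in> hom (presented P) X Y \<longleftrightarrow> mor x \<and> dm x = X \<and> cd x = Y"
  by (auto simp: presented_simps[OF adm] mor_def arrow_def)

lemma part_iff: "x \<in> part (presented P) X Y p \<longleftrightarrow> has_parity p x \<and> dm x = X \<and> cd x = Y"
  by (auto simp: presented_simps[OF adm] has_parity_def arrow_def)

lemma has_parity_mor: "has_parity p x \<Longrightarrow> mor x"
  by (auto simp: has_parity_def mor_def)

lemma has_parity_cls: "wt P t \<Longrightarrow> homog P p t \<Longrightarrow> has_parity p (cls P t)"
  by (auto simp: has_parity_def)

lemma mor_comp [simp]: "mor x \<Longrightarrow> mor y \<Longrightarrow> dm x = cd y \<Longrightarrow> mor (x \<cdot> y)"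
  and dm_comp [simp]: "mor x \<Longrightarrow> mor y \<Longrightarrow> dm x = cd y \<Longrightarrow> dm (x \<cdot> y) = dm y"
  and cd_comp [simp]: "mor x \<Longrightarrow> mor y \<Longrightarrow> dm x = cd y \<Longrightarrow> cd (x \<cdot> y) = cd x"
  using smc.comp_hom[of x "dm x" "cd x" y "dm y"] by (auto simp: hom_iff)

lemma mor_tens [simp]: "mor x \<Longrightarrow> mor y \<Longrightarrow> mor (x \<parallel> y)"
  and dm_tens [simp]: "mor x \<Longrightarrow> mor y \<Longrightarrow> dm (x \<parallel> y) = dm x @ dm y"
  and cd_tens [simp]: "mor x \<Longrightarrow> mor y \<Longrightarrow> cd (x \<parallel> y) = cd x @ cd y"
  using smc.tensor_hom[of x "dm x" "cd x" y "dm y" "cd y"]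
  by (auto simp: hom_iff presented_simps(6)[OF adm])

lemma mor_scale [simp]: "mor x \<Longrightarrow> mor (a \<star> x)"
  and dm_scale [simp]: "mor x \<Longrightarrow> dm (a \<star> x) = dm x"
  and cd_scale [simp]: "mor x \<Longrightarrow> cd (a \<star> x) = cd x"
  using smc.scale_hom[of x "dm x" "cd x" a] by (auto simp: hom_iff)

lemma mor_add [simp]: "mor x \<Longrightarrow> mor y \<Longrightarrow> dm x = dm y \<Longrightarrow> cd x = cd y \<Longrightarrow> mor (x \<boxplus> y)"
  and dm_add [simp]: "mor x \<Longrightarrow> mor y \<Longrightarrow> dm x = dm y \<Longrightarrow> cd x = cd y \<Longrightarrow> dm (x \<boxplus> y) = dm x"
  and cd_add [simp]: "mor x \<Longrightarrow> mor y \<Longrightarrow> dm x = dm y \<Longrightarrow> cd x = cd y \<Longrightarrow> cd (x \<boxplus> y) = cd x"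
  using smc.add_hom[of x "dm x" "cd x" y] by (auto simp: hom_iff)

lemma has_parity_comp: "has_parity p x \<Longrightarrow> has_parity q y \<Longrightarrow> dm x = cd y \<Longrightarrow> has_parity (p \<noteq> q) (x \<cdot> y)"
  using smc.comp_part[of x "dm x" "cd x" p y "dm y" q] by (auto simp: part_iff)

lemma has_parity_tens: "has_parity p x \<Longrightarrow> has_parity q y \<Longrightarrow> has_parity (p \<noteq> q) (x \<parallel> y)"
  using smc.tensor_part[of x "dm x" "cd x" p y "dm y" "cd y" q] by (auto simp: part_iff)

lemma has_parity_scale [simp]: "has_parity p x \<Longrightarrow> has_parity p (a \<star> x)"
  using smc.scale_part[of x "dm x" "cd x" p a] by (auto simp: part_iff)

lemma has_parity_add: "has_parity p x \<Longrightarrow> has_parity p y \<Longrightarrow> dm x = dm y \<Longrightarrow> cd x = cd y \<Longrightarrow>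
    has_parity p (x \<boxplus> y)"
  using smc.add_part[of x "dm x" "cd x" p y] by (auto simp: part_iff)

lemma has_parity_id [simp]: "has_parity False (\<iota> X)"
  by (auto intro: has_parity_cls homog.intros)

lemma has_parity_zero [simp]: "has_parity p (\<zeta> X Y)"
  by (auto intro: has_parity_cls homog.intros)

lemma even_comp [simp]: "has_parity False x \<Longrightarrow> has_parity False y \<Longrightarrow> dm x = cd y \<Longrightarrow> has_parity False (x \<cdot> y)"
  using has_parity_comp[of False x False y] by simp

lemma comp_eq: "x \<cdot> y = (\<Union>f\<in>x. \<Union>g\<in>y. cls P (f \<bullet> g))"
  by (simp add: presented_def)

lemma cls_mem: "s \<in> cls P t \<Longrightarrow> cls P s = cls P t"
  using in_cls[of s t] cls_eq[OF adm, of t s] by (simp add: cls_def)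

text \<open>All members of a class have the same class, so a single representative suffices; if
  \<open>t\<close> is ill-typed, both sides are empty.\<close>

lemma cls_comp_set: "cls P t \<cdot> w = (\<Union>h\<in>w. cls P (t \<bullet> h))"
proof (cases "wt P t")
  case True
  have "cls P t \<cdot> w = (\<Union>s\<in>cls P t. \<Union>h\<in>w. cls P (t \<bullet> h))"
    unfolding comp_eq by (intro SUP_cong refl) (simp_all add: cls_Comp cls_mem)
  then show ?thesis using cls_self[OF True] by auto
qed (simp add: comp_eq cls_empty)

lemma set_comp_cls: "w \<cdot> cls P t = (\<Union>h\<in>w. cls P (h \<bullet> t))"
proof (cases "wt P t")
  case True
  have "w \<cdot> cls P t = (\<Union>h\<in>w. \<Union>s\<in>cls P t. cls P (h \<bullet> t))"
    unfolding comp_eq by (intro SUP_cong refl) (simp_all add: cls_Comp cls_mem)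
  then show ?thesis using cls_self[OF True] by auto
qed (simp add: comp_eq cls_empty)

lemma comp_assoc: "(x \<cdot> y) \<cdot> w = x \<cdot> y \<cdot> w"
proof -
  have assoc: "cls P (f \<bullet> g \<bullet> h) = cls P (f \<bullet> (g \<bullet> h))" for f g h
  proof (cases "wt P (f \<bullet> g \<bullet> h)")
    case True
    then show ?thesis by (rule cls_eqI[OF adm, OF eqv.Comp_assoc])
  next
    case False
    then have "\<not> wt P (f \<bullet> (g \<bullet> h))" by auto
    then show ?thesis using cls_empty False by metis
  qed
  have U: "(\<Union>i\<in>I. F i) \<cdot> v = (\<Union>i\<in>I. F i \<cdot> v)" "v \<cdot> (\<Union>i\<in>I. F i) = (\<Union>i\<in>I. v \<cdot> F i)"
    for I :: "('k, 'o, 'g) trm set" and F v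
    by (auto simp: presented_def)
  have E: "a \<cdot> b = (\<Union>f\<in>a. \<Union>g\<in>b. cls P (f \<bullet> g))" for a b
    by (simp add: presented_def)
  have "(x \<cdot> y) \<cdot> w = (\<Union>f\<in>x. \<Union>g\<in>y. \<Union>h\<in>w. cls P (f \<bullet> g \<bullet> h))"
    by (simp only: E[of x y] U cls_comp_set)
  also have "\<dots> = (\<Union>f\<in>x. \<Union>g\<in>y. \<Union>h\<in>w. cls P (f \<bullet> (g \<bullet> h)))"
    by (simp only: assoc)
  also have "\<dots> = x \<cdot> y \<cdot> w"
    by (rule set_eqI, simp only: E[of y w] U set_comp_cls UN_iff) fast
  finally show ?thesis .
qed

lemma id_comp [simp]: "mor x \<Longrightarrow> cd x = Y \<Longrightarrow> \<iota> Y \<cdot> x = x"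
  and comp_id [simp]: "mor x \<Longrightarrow> dm x = X \<Longrightarrow> x \<cdot> \<iota> X = x"
  using smc.ident_comp[of x "dm x" "cd x"] smc.comp_ident[of x "dm x" "cd x"]
  by (auto simp: hom_iff presented_simps(4)[OF adm])

lemma scale_comp [simp]: "mor x \<Longrightarrow> mor y \<Longrightarrow> dm x = cd y \<Longrightarrow> (a \<star> x) \<cdot> y = a \<star> x \<cdot> y"
  and comp_scale [simp]: "mor x \<Longrightarrow> mor y \<Longrightarrow> dm x = cd y \<Longrightarrow> x \<cdot> (a \<star> y) = a \<star> x \<cdot> y"
  using smc.comp_scale_left[of x "dm x" "cd x" y "dm y" a]
    smc.comp_scale_right[of x "dm x" "cd x" y "dm y" a]
  by (auto simp: hom_iff)

lemma scale_scale [simp]: "mor x \<Longrightarrow> a \<star> (b \<star> x) = (a * b) \<star> x"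
  and scale_one [simp]: "mor x \<Longrightarrow> 1 \<star> x = x"
  using smc.scale_scale[of x "dm x" "cd x" a b] smc.scale_one[of x "dm x" "cd x"]
  by (auto simp: hom_iff)

lemma add_comp: "mor x \<Longrightarrow> mor x' \<Longrightarrow> mor y \<Longrightarrow> dm x = cd y \<Longrightarrow> dm x' = cd y \<Longrightarrow> cd x' = cd x \<Longrightarrow>
    (x \<boxplus> x') \<cdot> y = x \<cdot> y \<boxplus> x' \<cdot> y"
  using smc.comp_add_left[of x "dm x" "cd x" x' y "dm y"] by (auto simp: hom_iff)

lemma comp_add: "mor x \<Longrightarrow> mor y \<Longrightarrow> mor y' \<Longrightarrow> dm x = cd y \<Longrightarrow> dm x = cd y' \<Longrightarrow> dm y' = dm y \<Longrightarrow>
    x \<cdot> (y \<boxplus> y') = x \<cdot> y \<boxplus> x \<cdot> y'"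
  using smc.comp_add_right[of x "dm x" "cd x" y "dm y" y'] by (auto simp: hom_iff)

lemma scale_add: "mor x \<Longrightarrow> mor y \<Longrightarrow> dm x = dm y \<Longrightarrow> cd x = cd y \<Longrightarrow>
    a \<star> (x \<boxplus> y) = a \<star> x \<boxplus> a \<star> y"
  using smc.scale_add[of x "dm x" "cd x" y a] by (auto simp: hom_iff)

lemma comp_zero [simp]: "mor x \<Longrightarrow> dm x = Y \<Longrightarrow> x \<cdot> \<zeta> X Y = \<zeta> X (cd x)"
  using cls_eqI[OF adm Comp_Zero[OF adm]] by (auto simp: mor_def cls_Comp arrow_def)

lemma zero_comp [simp]: "mor x \<Longrightarrow> cd x = Y \<Longrightarrow> \<zeta> Y Z \<cdot> x = \<zeta> (dm x) Z"
  using cls_eqI[OF adm Zero_Comp[OF adm]] by (auto simp: mor_def cls_Comp arrow_def)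

lemma scale_zero [simp]: "a \<star> \<zeta> X Y = \<zeta> X Y"
  using cls_eqI[OF adm Scale_Zero[OF adm]] by (simp add: cls_Scale)

lemma add_zero [simp]: "mor x \<Longrightarrow> X = dm x \<Longrightarrow> Y = cd x \<Longrightarrow> x \<boxplus> \<zeta> X Y = x"
  and zero_add [simp]: "mor x \<Longrightarrow> X = dm x \<Longrightarrow> Y = cd x \<Longrightarrow> \<zeta> X Y \<boxplus> x = x"
  using smc.add_zero[of x "dm x" "cd x"] smc.add_commute[of x "dm x" "cd x" "\<zeta> X Y"]
  by (auto simp: hom_iff presented_simps(3)[OF adm])

lemma tens_id [simp]: "\<iota> X \<parallel> \<iota> Y = \<iota> (X @ Y)"
  using smc.tensor_ident[of X Y] by (simp add: presented_simps[OF adm])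

lemma tens_assoc: "mor x \<Longrightarrow> mor y \<Longrightarrow> mor w \<Longrightarrow> (x \<parallel> y) \<parallel> w = x \<parallel> y \<parallel> w"
  using smc.tensor_assoc[of x "dm x" "cd x" y "dm y" "cd y" w "dm w" "cd w"] by (simp add: hom_iff)

lemma unit_tens [simp]: "mor x \<Longrightarrow> \<iota> [] \<parallel> x = x"
  and tens_unit [simp]: "mor x \<Longrightarrow> x \<parallel> \<iota> [] = x"
  using smc.unit_tensor[of x "dm x" "cd x"] smc.tensor_unit[of x "dm x" "cd x"]
  by (auto simp: hom_iff presented_simps(4,5)[OF adm])

lemma tens_comp:
  assumes "mor x" "has_parity p x'" "has_parity q y" "mor y'" "dm x = cd x'" "dm y = cd y'"
  shows "(x \<parallel> y) \<cdot> (x' \<parallel> y') = koszul_sign p q \<star> ((x \<cdot> x') \<parallel> (y \<cdot> y'))"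
  using smc.super_interchange[of x "cd x'" "cd x" x' "dm x'" p y "cd y'" "cd y" q y' "dm y'"] assms
  by (auto simp: hom_iff part_iff has_parity_mor)

lemma koszul_simps [simp]:
  "koszul_sign False q = 1" "koszul_sign p False = 1" "koszul_sign True True = - 1"
  by (auto simp: koszul_sign_def)

section \<open>Whiskering and the exchange of distant morphisms\<close>

lemma mor_wh [simp]: "mor x \<Longrightarrow> mor (wh A x B)"
  and dm_wh [simp]: "mor x \<Longrightarrow> dm (wh A x B) = A @ dm x @ B"
  and cd_wh [simp]: "mor x \<Longrightarrow> cd (wh A x B) = A @ cd x @ B"
  by (simp_all add: wh_def)

lemma has_parity_wh [simp]: "has_parity p x \<Longrightarrow> has_parity p (wh A x B)"
  unfolding wh_def
  using has_parity_tens[OF has_parity_id has_parity_tens[OF _ has_parity_id]] by simp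

lemma wh_nil [simp]: "mor x \<Longrightarrow> wh [] x [] = x"
  by (simp add: wh_def)

lemma wh_id [simp]: "wh A (\<iota> X) B = \<iota> (A @ X @ B)"
  by (simp add: wh_def)

lemma wh_wh [simp]: "mor x \<Longrightarrow> wh A (wh A' x B') B = wh (A @ A') x (B' @ B)"
  by (simp add: wh_def tens_assoc del: tens_id add: tens_id[symmetric])

text \<open>The interchange law speaks of homogeneous factors only. Splitting into parity components
  extends those instances of it in which no sign appears to all morphisms.\<close>

lemma mor_split:
  assumes "mor x"
  obtains u v where "has_parity False u" "has_parity True v" "x = u \<boxplus> v" "dm u = dm x" "cd u = cd x"
    "dm v = dm x" "cd v = cd x"
proof -
  have "x \<in> hom (presented P) (dm x) (cd x)" using assms by (simp add: hom_iff)
  from ex1_implies_ex[OF smc.direct_sum[OF this]] that show ?thesis by (auto simp: part_iff)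
qed

lemma wh_comp:
  assumes "mor x" "mor y" "dm x = cd y"
  shows "wh A (x \<cdot> y) B = wh A x B \<cdot> wh A y B"
proof -
  \<comment> \<open>Interchange moves \<open>x\<close> past an identity here, so \<open>x\<close> is
    the factor to split, and both components get the sign 1. In \<open>R\<close> below that factor
    is \<open>y\<close>.\<close>
  have L: "\<iota> A \<parallel> (x \<cdot> y) = (\<iota> A \<parallel> x) \<cdot> (\<iota> A \<parallel> y)" if m: "mor x" "mor y" "dm x = cd y" for x y
  proof -
    obtain u v where uv: "has_parity False u" "has_parity True v" "x = u \<boxplus> v" "dm u = dm x" "cd u = cd x"
      "dm v = dm x" "cd v = cd x" using mor_split[OF m(1)] .
    note [simp] = has_parity_mor[OF uv(1)] has_parity_mor[OF uv(2)]
    have d [simp]: "dm u = cd y" "dm v = cd y" "cd v = cd u" using uv(4-7) m by auto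
    have E: "\<iota> A \<parallel> (u \<boxplus> v) = (\<iota> A \<parallel> u) \<boxplus> (\<iota> A \<parallel> v)"
      "\<iota> A \<parallel> (u \<cdot> y \<boxplus> v \<cdot> y) = (\<iota> A \<parallel> (u \<cdot> y)) \<boxplus> (\<iota> A \<parallel> (v \<cdot> y))"
      by (rule smc.tensor_add_right; simp add: hom_iff m)+
    show ?thesis
      using tens_comp[of "\<iota> A" False "\<iota> A" False u y] tens_comp[of "\<iota> A" False "\<iota> A" True v y]
      unfolding uv(3) by (simp add: E add_comp m(1,2) uv(1,2))
  qed
  have R: "(x \<cdot> y) \<parallel> \<iota> B = (x \<parallel> \<iota> B) \<cdot> (y \<parallel> \<iota> B)" if m: "mor x" "mor y" "dm x = cd y" for x y
  proof -
    obtain u v where uv: "has_parity False u" "has_parity True v" "y = u \<boxplus> v" "dm u = dm y" "cd u = cd y"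
      "dm v = dm y" "cd v = cd y" using mor_split[OF m(2)] .
    note [simp] = has_parity_mor[OF uv(1)] has_parity_mor[OF uv(2)]
    have d [simp]: "cd u = dm x" "cd v = dm x" "dm v = dm u" using uv(4-7) m by auto
    have E: "(u \<boxplus> v) \<parallel> \<iota> B = (u \<parallel> \<iota> B) \<boxplus> (v \<parallel> \<iota> B)"
      "(x \<cdot> u \<boxplus> x \<cdot> v) \<parallel> \<iota> B = ((x \<cdot> u) \<parallel> \<iota> B) \<boxplus> ((x \<cdot> v) \<parallel> \<iota> B)"
      by (rule smc.tensor_add_left; simp add: hom_iff m)+
    show ?thesis
      using tens_comp[of x False u False "\<iota> B" "\<iota> B"] tens_comp[of x True v False "\<iota> B" "\<iota> B"]
      unfolding uv(3) by (simp add: E comp_add m(1,2) uv(1,2))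
  qed
  show ?thesis using assms by (simp add: wh_def L R)
qed

lemma wh_scale [simp]: "mor x \<Longrightarrow> wh A (a \<star> x) B = a \<star> wh A x B"
  using smc.tensor_scale_right[of "\<iota> A" A A "x \<parallel> \<iota> B" "dm x @ B" "cd x @ B" a]
    smc.tensor_scale_left[of x "dm x" "cd x" "\<iota> B" B B a]
  by (simp add: wh_def hom_iff)

lemma wh_add: "mor x \<Longrightarrow> mor y \<Longrightarrow> dm x = dm y \<Longrightarrow> cd x = cd y \<Longrightarrow>
    wh A (x \<boxplus> y) B = wh A x B \<boxplus> wh A y B"
  using smc.tensor_add_right[of "\<iota> A" A A "x \<parallel> \<iota> B" "dm x @ B" "cd x @ B" "y \<parallel> \<iota> B"]
    smc.tensor_add_left[of x "dm x" "cd x" y "\<iota> B" B B]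
  by (simp add: wh_def hom_iff)

lemma wh_zero [simp]: "wh A (\<zeta> X Y) B = \<zeta> (A @ X @ B) (A @ Y @ B)"
  using cls_eqI[OF adm Tens_Zero[OF adm, of A A "Id A" "X @ B" "Y @ B"]]
    cls_eqI[OF adm Zero_Tens[OF adm, of B B "Id B" X Y]]
  by (simp add: wh_def cls_Tens arrow_def)

text \<open>In this order only identities are interchanged, so neither a sign nor a parity
  hypothesis arises. The opposite order costs the Koszul sign, which is
  \<open>exch0\<close>.\<close>

lemma tens_eq:
  assumes "mor x" "mor y"
  shows "x \<parallel> y = wh [] x (cd y) \<cdot> wh (dm x) y []"
  using tens_comp[of x False "\<iota> (dm x)" False "\<iota> (cd y)" y] assms
  by (simp add: wh_def)

lemma exch0:
  assumes "has_parity p x" "has_parity q y"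
  shows "wh [] x (cd y) \<cdot> wh (dm x) y [] = koszul_sign p q \<star> wh (cd x) y [] \<cdot> wh [] x (dm y)"
  using tens_comp[of "\<iota> (cd x)" p x q y "\<iota> (dm y)"] tens_eq[of x y] assms
  by (cases p; cases q) (simp_all add: wh_def has_parity_mor)

lemma exch:
  assumes "has_parity p x" "has_parity q y"
  shows "wh A x (M @ cd y @ B) \<cdot> wh (A @ dm x @ M) y B =
    koszul_sign p q \<star> wh (A @ cd x @ M) y B \<cdot> wh A x (M @ dm y @ B)"
proof -
  note [simp] = has_parity_mor[OF assms(1)] has_parity_mor[OF assms(2)]
  have "wh A (wh [] x (cd (wh M y B)) \<cdot> wh (dm x) (wh M y B) []) [] =
    wh A (koszul_sign p q \<star> wh (cd x) (wh M y B) [] \<cdot> wh [] x (dm (wh M y B))) []"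
    using exch0[OF assms(1) has_parity_wh[OF assms(2), of M B]] by simp
  then show ?thesis by (simp add: wh_comp)
qed

lemma exch_even:
  assumes "has_parity False x" "has_parity False y"
  shows "wh A x (M @ cd y @ B) \<cdot> wh (A @ dm x @ M) y B = wh (A @ cd x @ M) y B \<cdot> wh A x (M @ dm y @ B)"
  using exch[OF assms, of A M B] assms by (simp add: has_parity_mor)

lemma whiskers_tens:
  "mor x \<Longrightarrow> x \<parallel> \<iota> B = wh [] x B" "mor x \<Longrightarrow> \<iota> A \<parallel> x = wh A x []"
  by (simp_all add: wh_def)

text \<open>Composites are kept nested to the right; this form rewrites two adjacent factors in
  front of a tail \<open>r\<close>. It has no typing conditions because \<open>comp_assoc\<close>
  has none.\<close>

lemma comp2: "a \<cdot> b = c \<Longrightarrow> a \<cdot> b \<cdot> r = c \<cdot> r"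
  by (metis comp_assoc)

lemma comp3: "a \<cdot> b \<cdot> c = d \<Longrightarrow> a \<cdot> b \<cdot> c \<cdot> r = d \<cdot> r"
  by (metis comp_assoc)

lemma add_assoc: "mor x \<Longrightarrow> mor y \<Longrightarrow> mor w \<Longrightarrow> dm y = dm x \<Longrightarrow> dm w = dm x \<Longrightarrow> cd y = cd x \<Longrightarrow>
    cd w = cd x \<Longrightarrow> (x \<boxplus> y) \<boxplus> w = x \<boxplus> (y \<boxplus> w)"
  using smc.add_assoc[of x "dm x" "cd x" y w] by (simp add: hom_iff)

lemma add_cancel: "mor x \<Longrightarrow> a \<star> x \<boxplus> (- a) \<star> x = \<zeta> (dm x) (cd x)"
  using smc.add_neg[of "a \<star> x" "dm x" "cd x"] by (simp add: hom_iff presented_simps(3)[OF adm])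

end


section \<open>A half-braiding on the quantum isomeric supercategory\<close>

locale quantum_isomeric =
  fixes z :: "'k::comm_ring_1"
begin

sublocale admissible_presentation "Q_pres z"
  by (simp add: admissible_presentation.intro admissible_Q)

notation comp_mor (infixr \<open>\<cdot>\<close> 70)
notation tens_mor (infixr \<open>\<parallel>\<close> 75)
notation add_mor (infixl \<open>\<boxplus>\<close> 65)
notation scale_mor (infixr \<open>\<star>\<close> 68)
notation idt (\<open>\<iota>\<close>)
notation nul (\<open>\<zeta>\<close>)

lemma Q_pres_simps [simp]:
  "gsrc (Q_pres z) = q_src" "gtgt (Q_pres z) = q_tgt" "gpar (Q_pres z) = q_par"
  "rels (Q_pres z) = Q_rels z"
  by (simp_all add: Q_pres_def)

section \<open>Generators and relations of Q as classes\<close>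

abbreviation gen where "gen g \<equiv> cls (Q_pres z) (Gen g)"
abbreviation "up \<equiv> gen U_plus"
abbreviation "um \<equiv> gen U_minus"
abbreviation "rm \<equiv> gen R_minus"
abbreviation "cap \<equiv> gen Cap_L"
abbreviation "cup \<equiv> gen Cup_L"
abbreviation "c \<equiv> gen C_dot"

lemma even_gen [simp]: "g \<noteq> C_dot \<Longrightarrow> has_parity False (gen g)"
  by (auto intro!: has_parity_cls homog_Gen simp: q_par_def)

lemma odd_c [simp]: "has_parity True c"
  by (auto intro!: has_parity_cls homog_Gen simp: q_par_def)

lemma cls_rel: "(l, r) \<in> Q_rels z \<Longrightarrow> cls (Q_pres z) l = cls (Q_pres z) r"
  by (rule cls_eqI[OF adm]) (simp add: eqv.rel)

text \<open>The mate of x : X Up -> Up X under the duality given by cap_L and cup_L. The morphism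
  l^+ is the mate of u^+.\<close>

definition rot where
  "rot X x = wh [] cap (X @ [Dn]) \<cdot> wh [Dn] x [Dn] \<cdot> wh (Dn # X) cup []"

definition lp where "lp = rot [Up] up"

lemmas to_set = cls_Comp cls_Tens whiskers_tens comp_assoc

lemma rels:
  shows um_up: "um \<cdot> up = \<iota> [Up, Up]"
    and up_um: "up \<cdot> um = \<iota> [Up, Up]"
    and lp_rm: "lp \<cdot> rm = \<iota> [Up, Dn]"
    and rm_lp: "rm \<cdot> lp = \<iota> [Dn, Up]"
    and braid: "wh [] up [Up] \<cdot> wh [Up] up [] \<cdot> wh [] up [Up] =
      wh [Up] up [] \<cdot> wh [] up [Up] \<cdot> wh [Up] up []"
    and skein: "up \<boxplus> (- 1) \<star> um = z \<star> \<iota> [Up, Up]"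
    and c_c: "c \<cdot> c = (- 1) \<star> \<iota> [Up]"
    and up_c: "up \<cdot> wh [] c [Up] = wh [Up] c [] \<cdot> up"
    and bubble_c: "cap \<cdot> rm \<cdot> wh [] c [Dn] \<cdot> cup = \<zeta> [] []"
    and bubble: "cap \<cdot> rm \<cdot> cup = \<zeta> [] []"
    and zigzag_up: "wh [Up] cap [] \<cdot> wh [] cup [Up] = \<iota> [Up]"
    and zigzag_dn: "wh [] cap [Dn] \<cdot> wh [Dn] cup [] = \<iota> [Dn]"
proof -
  have "\<forall>x\<in>Q_rels z. cls (Q_pres z) (fst x) = cls (Q_pres z) (snd x)"
    by (auto dest: cls_rel)
  note R = this[unfolded Q_rels_def, simplified, simplified cls_Add cls_Scale wt.simps]
  show "um \<cdot> up = \<iota> [Up, Up]" "up \<cdot> um = \<iota> [Up, Up]" "lp \<cdot> rm = \<iota> [Up, Dn]"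
    "rm \<cdot> lp = \<iota> [Dn, Up]"
    "wh [] up [Up] \<cdot> wh [Up] up [] \<cdot> wh [] up [Up] =
      wh [Up] up [] \<cdot> wh [] up [Up] \<cdot> wh [Up] up []"
    "up \<boxplus> (- 1) \<star> um = z \<star> \<iota> [Up, Up]" "c \<cdot> c = (- 1) \<star> \<iota> [Up]"
    "up \<cdot> wh [] c [Up] = wh [Up] c [] \<cdot> up"
    "cap \<cdot> rm \<cdot> wh [] c [Dn] \<cdot> cup = \<zeta> [] []" "cap \<cdot> rm \<cdot> cup = \<zeta> [] []"
    "wh [Up] cap [] \<cdot> wh [] cup [Up] = \<iota> [Up]" "wh [] cap [Dn] \<cdot> wh [Dn] cup [] = \<iota> [Dn]"
    using R by (simp_all add: l_plus_def cap_R_def lp_def rot_def to_set cls_Add cls_Scale)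
qed

section \<open>Mates under left duality\<close>

context
  fixes X x
  assumes x [simp]: "has_parity False x" "mor x" "dm x = X @ [Up]" "cd x = Up # X"
begin

lemma has_parity_rot [simp]: "has_parity False (rot X x)"
  and mor_rot [simp]: "mor (rot X x)"
  and dm_rot [simp]: "dm (rot X x) = Dn # X"
  and cd_rot [simp]: "cd (rot X x) = X @ [Dn]"
  by (simp_all add: rot_def)

text \<open>The outer cap slides down to the cup inside \<open>rot\<close> and the two straighten by
  \<open>zigzag_up\<close>; \<open>rot_cup\<close> is the mirror image. They let a crossing be
  pulled through a cap or a cup, at the price of taking its mate.\<close>

lemma rot_cap: "wh X cap [] \<cdot> wh [] (rot X x) [Up] = wh [] cap X \<cdot> wh [Dn] x []"
proof -
  have e1: "wh X cap [] \<cdot> wh [] cap (X @ [Dn, Up]) = wh [] cap X \<cdot> wh (Dn # Up # X) cap []"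
    using exch_even[of cap cap "[]" X "[]"] by simp
  have e2: "wh (Dn # Up # X) cap [] \<cdot> wh [Dn] x [Dn, Up] = wh [Dn] x [] \<cdot> wh (Dn # X @ [Up]) cap []"
    using exch_even[of x cap "[Dn]" "[]" "[]"] by simp
  have e3: "wh (Dn # X @ [Up]) cap [] \<cdot> wh (Dn # X) cup [Up] = \<iota> (Dn # X @ [Up])"
    using arg_cong[OF zigzag_up, of "\<lambda>t. wh (Dn # X) t []"] by (simp add: wh_comp)
  show ?thesis
    by (simp add: rot_def wh_comp comp2[OF e1] comp_assoc comp2[OF e2] e3)
qed

lemma rot_cup: "wh [Up] (rot X x) [] \<cdot> wh [] cup X = wh [] x [Dn] \<cdot> wh X cup []"
proof -
  have e1: "wh (Up # Dn # X) cup [] \<cdot> wh [] cup X = wh [] cup (X @ [Up, Dn]) \<cdot> wh X cup []"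
    using exch_even[of cup cup "[]" X "[]"] by simp
  have e2: "wh [Up, Dn] x [Dn] \<cdot> wh [] cup (X @ [Up, Dn]) = wh [] cup (Up # X @ [Dn]) \<cdot> wh [] x [Dn]"
    using exch_even[of cup x "[]" "[]" "[Dn]"] by simp
  have e3: "wh [Up] cap (X @ [Dn]) \<cdot> wh [] cup (Up # X @ [Dn]) = \<iota> (Up # X @ [Dn])"
    using arg_cong[OF zigzag_up, of "\<lambda>t. wh [] t (X @ [Dn])"] by (simp add: wh_comp)
  show ?thesis
    by (simp add: rot_def wh_comp comp_assoc e1 comp2[OF e2] comp2[OF e3])
qed

text \<open>The bent strand travels in the other direction, so taking mates reverses the order in
  which X and Y are crossed.\<close>

lemma rot_mult:
  assumes y [simp]: "has_parity False y" "mor y" "dm y = Y @ [Up]" "cd y = Up # Y"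
  shows "rot (X @ Y) (wh [] x Y \<cdot> wh X y []) = wh X (rot Y y) [] \<cdot> wh [] (rot X x) Y"
proof -
  have e1: "wh (X @ Dn # Y) cup [] \<cdot> wh [] (rot X x) Y =
      wh [] (rot X x) (Y @ [Up, Dn]) \<cdot> wh (Dn # X @ Y) cup []"
    using exch_even[of "rot X x" cup "[]" Y "[]"] by simp
  have e2: "wh (X @ [Dn]) y [Dn] \<cdot> wh [] (rot X x) (Y @ [Up, Dn]) =
      wh [] (rot X x) (Up # Y @ [Dn]) \<cdot> wh (Dn # X) y [Dn]"
    using exch_even[of "rot X x" y "[]" "[]" "[Dn]"] by simp
  have e3: "wh X cap (Y @ [Dn]) \<cdot> wh [] (rot X x) (Up # Y @ [Dn]) =
      wh [] cap (X @ Y @ [Dn]) \<cdot> wh [Dn] x (Y @ [Dn])"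
    using arg_cong[OF rot_cap, of "\<lambda>t. wh [] t (Y @ [Dn])"] by (simp add: wh_comp)
  have "wh X (rot Y y) [] \<cdot> wh [] (rot X x) Y =
      wh X cap (Y @ [Dn]) \<cdot> wh (X @ [Dn]) y [Dn] \<cdot> wh (X @ Dn # Y) cup [] \<cdot> wh [] (rot X x) Y"
    by (simp add: rot_def[of Y] wh_comp comp_assoc)
  also have "\<dots> = wh [] cap (X @ Y @ [Dn]) \<cdot> wh [Dn] x (Y @ [Dn]) \<cdot> wh (Dn # X) y [Dn] \<cdot>
      wh (Dn # X @ Y) cup []"
    by (simp only: e1 comp2[OF e2] comp2[OF e3] comp_assoc)
  also have "\<dots> = rot (X @ Y) (wh [] x Y \<cdot> wh X y [])"
    by (simp add: rot_def wh_comp comp_assoc)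
  finally show ?thesis by (rule HOL.sym)
qed

lemma rot_nat:
  assumes f [simp]: "has_parity False f" "mor f" "dm f = X" "cd f = Y"
    and y [simp]: "has_parity False y" "mor y" "dm y = Y @ [Up]" "cd y = Up # Y"
    and eq: "y \<cdot> wh [] f [Up] = wh [Up] f [] \<cdot> x"
  shows "rot Y y \<cdot> wh [Dn] f [] = wh [] f [Dn] \<cdot> rot X x"
proof -
  have e1: "wh (Dn # Y) cup [] \<cdot> wh [Dn] f [] = wh [Dn] f [Up, Dn] \<cdot> wh (Dn # X) cup []"
    using exch_even[of f cup "[Dn]" "[]" "[]"] by simp
  have e2: "wh [Dn] y [Dn] \<cdot> wh [Dn] f [Up, Dn] = wh [Dn, Up] f [Dn] \<cdot> wh [Dn] x [Dn]"
    using arg_cong[OF eq, of "\<lambda>t. wh [Dn] t [Dn]"] by (simp add: wh_comp)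
  have e3: "wh [] cap (Y @ [Dn]) \<cdot> wh [Dn, Up] f [Dn] = wh [] f [Dn] \<cdot> wh [] cap (X @ [Dn])"
    using exch_even[of cap f "[]" "[]" "[Dn]"] by simp
  show ?thesis
    by (simp add: rot_def comp_assoc e1 comp2[OF e2] comp2[OF e3])
qed

end


lemma has_parity_lp [simp]: "has_parity False lp"
  and mor_lp [simp]: "mor lp"
  and dm_lp [simp]: "dm lp = [Dn, Up]"
  and cd_lp [simp]: "cd lp = [Up, Dn]"
  by (simp_all add: lp_def)

text \<open>
  The crossings \<open>l\<^sup>-\<close> and \<open>r\<^sup>+\<close>: rotating the skein relation gives \<open>l\<^sup>- = l\<^sup>+ - z cup\<^sub>L cap\<^sub>L\<close>, and
  \<open>r\<^sup>+\<close> is its inverse because the bubble vanishes.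
\<close>

definition lm where "lm = rot [Up] um"
definition rp where "rp = rm \<boxplus> z \<star> rm \<cdot> cup \<cdot> cap \<cdot> rm"

lemma has_parity_lm [simp]: "has_parity False lm"
  and mor_lm [simp]: "mor lm"
  and dm_lm [simp]: "dm lm = [Dn, Up]"
  and cd_lm [simp]: "cd lm = [Up, Dn]"
  by (simp_all add: lm_def)

lemma has_parity_rp [simp]: "has_parity False rp"
  and mor_rp [simp]: "mor rp"
  and dm_rp [simp]: "dm rp = [Up, Dn]"
  and cd_rp [simp]: "cd rp = [Dn, Up]"
  by (simp_all add: rp_def has_parity_add)

lemma um_eq: "um = up \<boxplus> (- z) \<star> \<iota> [Up, Up]"
proof -
  have "up \<boxplus> (- z) \<star> \<iota> [Up, Up] = up \<boxplus> (- 1) \<star> (up \<boxplus> (- 1) \<star> um)"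
    by (simp add: skein)
  also have "\<dots> = (up \<boxplus> (- 1) \<star> up) \<boxplus> um"
    by (simp add: scale_add add_assoc)
  also have "\<dots> = um"
    using add_cancel[of up 1] by simp
  finally show ?thesis by (rule HOL.sym)
qed

lemma lm_eq: "lm = lp \<boxplus> (- z) \<star> cup \<cdot> cap"
proof -
  \<comment> \<open>The mate of the identity of Up Up, once the cap is slid past the cup.\<close>
  have "wh [] cap [Up, Dn] \<cdot> wh [Dn, Up] cup [] = cup \<cdot> cap"
    using exch_even[of cap cup "[]" "[]" "[]"] by simp
  then show ?thesis
    unfolding lm_def lp_def rot_def um_eq by (simp add: wh_add add_comp comp_add)
qed

text \<open>Put t = \<open>cup \<cdot> cap \<cdot> rm\<close>. The vanishing bubble gives t t = 0,
  so \<open>lm \<cdot> rm\<close> = 1 - z t has the inverse 1 + z t, and \<open>rp\<close> is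
  \<open>rm\<close> composed with 1 + z t.\<close>

lemma lm_rp: "lm \<cdot> rp = \<iota> [Up, Dn]"
proof -
  let ?t = "cup \<cdot> cap \<cdot> rm"
  have 1: "lm \<cdot> rm = \<iota> [Up, Dn] \<boxplus> (- z) \<star> ?t"
    by (simp add: lm_eq add_comp lp_rm comp_assoc)
  have "lm \<cdot> rm \<cdot> ?t = ?t"
    by (simp add: lm_eq add_comp comp2[OF lp_rm] comp_assoc comp3[OF bubble])
  then have "lm \<cdot> rp = (\<iota> [Up, Dn] \<boxplus> (- z) \<star> ?t) \<boxplus> z \<star> ?t"
    by (simp add: rp_def comp_add 1)
  \<comment> \<open>The coefficient \<open>z\<close> is written \<open>- (- z)\<close> to fit
    \<open>add_cancel\<close>.\<close>
  also have "\<dots> = \<iota> [Up, Dn] \<boxplus> ((- z) \<star> ?t \<boxplus> (- (- z)) \<star> ?t)"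
    by (simp add: add_assoc)
  also have "\<dots> = \<iota> [Up, Dn]"
    by (subst add_cancel) simp_all
  finally show ?thesis .
qed

lemma rp_lm: "rp \<cdot> lm = \<iota> [Dn, Up]"
proof -
  let ?t = "rm \<cdot> cup \<cdot> cap"
  have 1: "rm \<cdot> lm = \<iota> [Dn, Up] \<boxplus> (- z) \<star> ?t"
    by (simp add: lm_eq comp_add rm_lp)
  have "rm \<cdot> cup \<cdot> cap \<cdot> rm \<cdot> lm = ?t"
    by (simp add: lm_eq comp_add rm_lp comp_assoc comp3[OF bubble])
  then have "rp \<cdot> lm = (\<iota> [Dn, Up] \<boxplus> (- z) \<star> ?t) \<boxplus> z \<star> ?t"
    by (simp add: rp_def add_comp comp_assoc 1)
  also have "\<dots> = \<iota> [Dn, Up] \<boxplus> ((- z) \<star> ?t \<boxplus> (- (- z)) \<star> ?t)"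
    by (simp add: add_assoc)
  also have "\<dots> = \<iota> [Dn, Up]"
    by (subst add_cancel) simp_all
  finally show ?thesis .
qed

section \<open>Crossing an upward strand with a word\<close>

primrec braiding where "braiding Up = um" | "braiding Dn = rp"
primrec braiding' where "braiding' Up = up" | "braiding' Dn = lm"

lemma braiding_simps [simp]:
  "has_parity False (braiding a)" "mor (braiding a)" "dm (braiding a) = [Up, a]" "cd (braiding a) = [a, Up]"
  "has_parity False (braiding' a)" "mor (braiding' a)" "dm (braiding' a) = [a, Up]" "cd (braiding' a) = [Up, a]"
  by (cases a; simp)+

lemma braiding_inv: "braiding a \<cdot> braiding' a = \<iota> [a, Up]" "braiding' a \<cdot> braiding a = \<iota> [Up, a]"
  by (cases a; simp add: um_up up_um lm_rp rp_lm)+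

primrec half_braid where
  "half_braid [] = \<iota> [Up]"
| "half_braid (a # X) = wh [a] (half_braid X) [] \<cdot> wh [] (braiding a) X"

primrec half_braid' where
  "half_braid' [] = \<iota> [Up]"
| "half_braid' (a # X) = wh [] (braiding' a) X \<cdot> wh [a] (half_braid' X) []"

lemma mor_half_braid [simp]: "mor (half_braid X) \<and> dm (half_braid X) = Up # X \<and> cd (half_braid X) = X @ [Up] \<and> has_parity False (half_braid X)"
  by (induction X) auto

lemma mor_half_braid' [simp]: "mor (half_braid' X) \<and> dm (half_braid' X) = X @ [Up] \<and> cd (half_braid' X) = Up # X \<and> has_parity False (half_braid' X)"
  by (induction X) auto

lemma half_braid_inv: "half_braid' X \<cdot> half_braid X = \<iota> (Up # X)"
proof (induction X)
  case (Cons a X)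
  have e: "wh [a] (half_braid' X) [] \<cdot> wh [a] (half_braid X) [] = \<iota> (a # Up # X)"
    using arg_cong[OF Cons, of "\<lambda>t. wh [a] t []"] by (simp add: wh_comp)
  have "wh [] (braiding' a) X \<cdot> wh [] (braiding a) X = \<iota> (Up # a # X)"
    using arg_cong[OF braiding_inv(2), of "\<lambda>t. wh [] t X" a] by (simp add: wh_comp)
  then show ?case by (simp add: comp_assoc comp2[OF e])
qed simp

lemma half_braid_inv': "half_braid X \<cdot> half_braid' X = \<iota> (X @ [Up])"
proof (induction X)
  case (Cons a X)
  have e: "wh [] (braiding a) X \<cdot> wh [] (braiding' a) X = \<iota> (a # Up # X)"
    using arg_cong[OF braiding_inv(1), of "\<lambda>t. wh [] t X" a] by (simp add: wh_comp)
  have "wh [a] (half_braid X) [] \<cdot> wh [a] (half_braid' X) [] = \<iota> (a # X @ [Up])"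
    using arg_cong[OF Cons, of "\<lambda>t. wh [a] t []"] by (simp add: wh_comp)
  then show ?case by (simp add: comp_assoc comp2[OF e])
qed simp

lemma half_braid_append: "half_braid (X @ Y) = wh X (half_braid Y) [] \<cdot> wh [] (half_braid X) Y"
  by (induction X) (simp_all add: wh_comp comp_assoc)

lemma half_braid'_append: "half_braid' (X @ Y) = wh [] (half_braid' X) Y \<cdot> wh X (half_braid' Y) []"
  by (induction X) (simp_all add: wh_comp comp_assoc)

lemma half_braid_Up [simp]: "half_braid [Up] = um" and half_braid_Dn [simp]: "half_braid [Dn] = rp"
  and half_braid'_Up [simp]: "half_braid' [Up] = up" and half_braid'_Dn [simp]: "half_braid' [Dn] = lm"
  by simp_all

section \<open>Naturality of the half-braiding\<close>

definition natural where
  "natural p f \<longleftrightarrow> has_parity p f \<and> half_braid (cd f) \<cdot> wh [Up] f [] = wh [] f [Up] \<cdot> half_braid (dm f)"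

lemma natural_comp:
  assumes "natural p f" "natural q g" "dm f = cd g" shows "natural (p \<noteq> q) (f \<cdot> g)"
proof -
  have h: "has_parity p f" "has_parity q g" and eq: "half_braid (cd f) \<cdot> wh [Up] f [] = wh [] f [Up] \<cdot> half_braid (cd g)"
    "half_braid (cd g) \<cdot> wh [Up] g [] = wh [] g [Up] \<cdot> half_braid (dm g)"
    using assms by (auto simp: natural_def)
  note [simp] = has_parity_mor[OF h(1)] has_parity_mor[OF h(2)]
  show ?thesis
    using has_parity_comp[OF h assms(3)] by (simp add: natural_def assms(3) wh_comp comp2[OF eq(1)] eq(2) comp_assoc)
qed

lemma natural_even_comp: "natural False f \<Longrightarrow> natural False g \<Longrightarrow> dm f = cd g \<Longrightarrow> natural False (f \<cdot> g)"
  using natural_comp[of False f False g] by simp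

text \<open>Between its own naturality square, \<open>f\<close> passes the half-braidings of
  \<open>A\<close> and \<open>B\<close> by \<open>exch\<close>. That needs \<open>f\<close>
  homogeneous, which is why \<open>natural\<close> records a parity; the half-braidings are even, so
  no sign appears.\<close>

lemma natural_wh:
  assumes "natural p f" shows "natural p (wh A f B)"
proof -
  have h: "has_parity p f" and eq: "half_braid (cd f) \<cdot> wh [Up] f [] = wh [] f [Up] \<cdot> half_braid (dm f)"
    using assms by (auto simp: natural_def)
  note [simp] = has_parity_mor[OF h]
  have e1: "wh [] (half_braid A) (cd f @ B) \<cdot> wh (Up # A) f B = wh (A @ [Up]) f B \<cdot> wh [] (half_braid A) (dm f @ B)"
    using exch[of False "half_braid A" p f "[]" "[]" B] h by simp
  have e2: "wh A (half_braid (cd f)) B \<cdot> wh (A @ [Up]) f B = wh A f (Up # B) \<cdot> wh A (half_braid (dm f)) B"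
    using arg_cong[OF eq, of "\<lambda>t. wh A t B"] by (simp add: wh_comp)
  have e3: "wh (A @ cd f) (half_braid B) [] \<cdot> wh A f (Up # B) = wh A f (B @ [Up]) \<cdot> wh (A @ dm f) (half_braid B) []"
    using exch[of p f False "half_braid B" A "[]" "[]"] h by simp
  show ?thesis
    using h by (simp add: natural_def half_braid_append wh_comp comp_assoc e1 comp2[OF e2] comp2[OF e3])
qed

lemma natural_id: "natural False (\<iota> X)"
  by (simp add: natural_def)

lemma natural_zero: "natural p (\<zeta> X Y)"
  by (simp add: natural_def)

lemma natural_scale: "natural p f \<Longrightarrow> natural p (a \<star> f)"
  by (auto simp: natural_def dest: has_parity_mor)

lemma natural_add: "natural p f \<Longrightarrow> natural p g \<Longrightarrow> dm f = dm g \<Longrightarrow> cd f = cd g \<Longrightarrow> natural p (f \<boxplus> g)"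
  using has_parity_mor[of p f] has_parity_mor[of p g] by (simp add: natural_def wh_add comp_add add_comp has_parity_add)

text \<open>The naturality square of \<open>f\<close> is composed with \<open>g\<close> on both
  sides. This covers \<open>um\<close> and \<open>rm\<close>, which enter the relations as inverses
  of \<open>up\<close> and \<open>lp\<close>.\<close>

lemma natural_inverse:
  assumes "natural False f" "has_parity False g" "f \<cdot> g = \<iota> (cd f)" "g \<cdot> f = \<iota> (dm f)" "dm f = cd g" "cd f = dm g"
  shows "natural False g"
proof -
  have h: "has_parity False f" and eq: "half_braid (dm g) \<cdot> wh [Up] f [] = wh [] f [Up] \<cdot> half_braid (cd g)"
    using assms by (auto simp: natural_def)
  note [simp] = has_parity_mor[OF h] has_parity_mor[OF assms(2)] assms(2,5,6)
  have e1: "wh [] g [Up] \<cdot> wh [] f [Up] = \<iota> (cd g @ [Up])"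
    using arg_cong[OF assms(4), of "\<lambda>t. wh [] t [Up]"] by (simp add: wh_comp)
  have e2: "wh [Up] f [] \<cdot> wh [Up] g [] = \<iota> (Up # dm g)"
    using arg_cong[OF assms(3), of "\<lambda>t. wh [Up] t []"] by (simp add: wh_comp)
  have "half_braid (cd g) \<cdot> wh [Up] g [] = wh [] g [Up] \<cdot> (wh [] f [Up] \<cdot> half_braid (cd g)) \<cdot> wh [Up] g []"
    by (simp add: comp_assoc comp2[OF e1])
  also have "\<dots> = wh [] g [Up] \<cdot> half_braid (dm g)"
    by (simp add: eq[symmetric] comp_assoc e2)
  finally show ?thesis by (simp add: natural_def)
qed

text \<open>The relation \<open>up_c\<close> conjugated by \<open>um\<close>. The dot now moves from
  the right strand to the left one, as naturality requires.\<close>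

lemma um_c: "um \<cdot> wh [Up] c [] = wh [] c [Up] \<cdot> um"
proof -
  have "um \<cdot> wh [Up] c [] = um \<cdot> (wh [Up] c [] \<cdot> up) \<cdot> um"
    by (simp add: comp_assoc up_um)
  also have "\<dots> = wh [] c [Up] \<cdot> um"
    by (simp add: up_c[symmetric] comp_assoc comp2[OF um_up])
  finally show ?thesis .
qed

lemma natural_c: "natural True c"
  by (simp add: natural_def um_c del: half_braid.simps)

lemma natural_up: "natural False up"
proof -
  have wl: "wh [] up [Up] \<cdot> wh [] um [Up] = \<iota> [Up, Up, Up]" "wh [] um [Up] \<cdot> wh [] up [Up] = \<iota> [Up, Up, Up]"
    using arg_cong[OF up_um, of "\<lambda>t. wh [] t [Up]"] arg_cong[OF um_up, of "\<lambda>t. wh [] t [Up]"]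
    by (simp_all add: wh_comp)
  have wr: "wh [Up] up [] \<cdot> wh [Up] um [] = \<iota> [Up, Up, Up]" "wh [Up] um [] \<cdot> wh [Up] up [] = \<iota> [Up, Up, Up]"
    using arg_cong[OF up_um, of "\<lambda>t. wh [Up] t []"] arg_cong[OF um_up, of "\<lambda>t. wh [Up] t []"]
    by (simp_all add: wh_comp)
  \<comment> \<open>The braid relation is bordered by inverse crossings, so that one of its sides
    collapses to each side of the naturality square.\<close>
  have "wh [Up] um [] \<cdot> wh [] um [Up] \<cdot> wh [Up] up [] =
    wh [Up] um [] \<cdot> wh [] um [Up] \<cdot> (wh [Up] up [] \<cdot> wh [] up [Up] \<cdot> wh [Up] up []) \<cdot> wh [Up] um [] \<cdot> wh [] um [Up]"
    by (simp add: comp_assoc comp2[OF wr(1)] wl(1))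
  also have "\<dots> = wh [] up [Up] \<cdot> wh [Up] um [] \<cdot> wh [] um [Up]"
    by (simp add: braid[symmetric] comp_assoc comp2[OF wl(2)] comp2[OF wr(2)])
  finally show ?thesis by (simp add: natural_def comp_assoc)
qed

lemma natural_um: "natural False um"
  by (rule natural_inverse[OF natural_up]) (simp_all add: um_up up_um)

text \<open>Pulling the strand across the cup by \<open>rot_cup\<close> turns \<open>um\<close> into
  its mate \<open>lm\<close>; the crossing with the other leg must therefore invert
  \<open>lm\<close>, as \<open>rp\<close> does.\<close>

lemma natural_cup: "natural False cup"
proof -
  have "wh [Up] rp [] \<cdot> wh [Up] lm [] = \<iota> [Up, Dn, Up]"
    using arg_cong[OF rp_lm, of "\<lambda>t. wh [Up] t []"] by (simp add: wh_comp)
  note e = comp2[OF this]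
  have "wh [] um [Dn] \<cdot> wh [Up] cup [] = wh [Up] lm [] \<cdot> wh [] cup [Up]"
    using rot_cup[of um "[Up]"] by (simp add: lm_def)
  then show ?thesis by (simp add: natural_def comp_assoc e)
qed

lemma natural_cap: "natural False cap"
proof -
  have e: "wh [] lm [Up] \<cdot> wh [] rp [Up] = \<iota> [Up, Dn, Up]"
    using arg_cong[OF lm_rp, of "\<lambda>t. wh [] t [Up]"] by (simp add: wh_comp)
  have "wh [] cap [Up] \<cdot> wh [Dn] um [] = wh [Up] cap [] \<cdot> wh [] lm [Up]"
    using rot_cap[of um "[Up]"] by (simp add: lm_def[symmetric])
  from comp2[OF this] show ?thesis by (simp add: natural_def comp_assoc e)
qed

lemma natural_lp: "natural False lp"
  unfolding lp_def rot_def by (intro natural_even_comp natural_wh natural_cap natural_up natural_cup) simp_all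

lemma natural_rm: "natural False rm"
  by (rule natural_inverse[OF natural_lp]) (simp_all add: lp_rm rm_lp)

lemma natural_cls: "homog (Q_pres z) p t \<Longrightarrow> wt (Q_pres z) t \<Longrightarrow> natural p (cls (Q_pres z) t)"
proof (induction rule: homog.induct)
  case (1 g)
  then show ?case
    by (cases g) (simp_all add: q_par_def natural_up natural_um natural_cup natural_cap natural_rm natural_c)
next
  case (6 p f q g)
  then show ?case using natural_comp[of p "cls (Q_pres z) f" q "cls (Q_pres z) g"] by (simp add: cls_Comp)
next
  case (7 p f q g)
  have "natural (p \<noteq> q) (wh [] (cls (Q_pres z) f) (tgt (Q_pres z) g) \<cdot> wh (src (Q_pres z) f) (cls (Q_pres z) g) [])"
    using 7 by (intro natural_comp natural_wh) auto
  then show ?case using 7 by (simp add: cls_Tens tens_eq)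
qed (auto simp: cls_Add cls_Scale natural_id natural_zero natural_add natural_scale)

text \<open>
  \<open>tau X\<close> moves a downward strand through \<open>X\<close>; together with the half-braiding it moves the pair
  \<open>[Dn, Up]\<close>, hence a bubble, through \<open>X\<close>. That the right cup slides along reduces to the case of
  one strand; the case \<open>[Up]\<close> is the braid relation, and \<open>[Dn]\<close> follows from it by duality.
\<close>

definition tau where "tau X = rot X (half_braid' X)"
definition cupR where "cupR = rm \<cdot> cup"
definition pair_braid where "pair_braid X = wh [] (tau X) [Up] \<cdot> wh [Dn] (half_braid X) []"

lemma tau_typ [simp]: "has_parity False (tau X)" "mor (tau X)" "dm (tau X) = Dn # X" "cd (tau X) = X @ [Dn]"
  by (simp_all add: tau_def)

lemma cupR_typ [simp]: "has_parity False cupR" "mor cupR" "dm cupR = []" "cd cupR = [Dn, Up]"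
  by (simp_all add: cupR_def)

lemma pair_braid_typ [simp]: "has_parity False (pair_braid X)" "mor (pair_braid X)" "dm (pair_braid X) = Dn # Up # X" "cd (pair_braid X) = X @ [Dn, Up]"
  by (simp_all add: pair_braid_def)

lemma tau_append: "tau (X @ Y) = wh X (tau Y) [] \<cdot> wh [] (tau X) Y"
  unfolding tau_def half_braid'_append by (rule rot_mult) simp_all

lemma tau_nat:
  assumes "natural False f"
  shows "tau (cd f) \<cdot> wh [Dn] f [] = wh [] f [Dn] \<cdot> tau (dm f)"
proof -
  have h: "has_parity False f" and eq: "half_braid (cd f) \<cdot> wh [Up] f [] = wh [] f [Up] \<cdot> half_braid (dm f)"
    using assms by (auto simp: natural_def)
  note [simp] = has_parity_mor[OF h]
  have "half_braid' (cd f) \<cdot> wh [] f [Up] = half_braid' (cd f) \<cdot> (wh [] f [Up] \<cdot> half_braid (dm f)) \<cdot> half_braid' (dm f)"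
    by (simp add: comp_assoc half_braid_inv')
  also have "\<dots> = wh [Up] f [] \<cdot> half_braid' (dm f)"
    by (simp add: eq[symmetric] comp_assoc comp2[OF half_braid_inv])
  finally show ?thesis
    unfolding tau_def using h by (intro rot_nat) simp_all
qed

lemma pair_braid_append: "pair_braid (X @ Y) = wh X (pair_braid Y) [] \<cdot> wh [] (pair_braid X) Y"
proof -
  have "wh [] (tau X) (Y @ [Up]) \<cdot> wh (Dn # X) (half_braid Y) [] = wh (X @ [Dn]) (half_braid Y) [] \<cdot> wh [] (tau X) (Up # Y)"
    using exch_even[of "tau X" "half_braid Y" "[]" "[]" "[]"] by simp
  from comp2[OF this] show ?thesis
    by (simp add: pair_braid_def tau_append half_braid_append wh_comp comp_assoc)
qed

lemma tau_nil [simp]: "tau [] = \<iota> [Dn]"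
  by (simp add: tau_def rot_def zigzag_dn)

lemma pair_braid_nil [simp]: "pair_braid [] = \<iota> [Dn, Up]"
  by (simp add: pair_braid_def)

lemma pair_braid_nat:
  assumes "natural False f"
  shows "pair_braid (cd f) \<cdot> wh [Dn, Up] f [] = wh [] f [Dn, Up] \<cdot> pair_braid (dm f)"
proof -
  have h: "has_parity False f" and eq: "half_braid (cd f) \<cdot> wh [Up] f [] = wh [] f [Up] \<cdot> half_braid (dm f)"
    using assms by (auto simp: natural_def)
  note [simp] = has_parity_mor[OF h]
  have e1: "wh [Dn] (half_braid (cd f)) [] \<cdot> wh [Dn, Up] f [] = wh [Dn] f [Up] \<cdot> wh [Dn] (half_braid (dm f)) []"
    using arg_cong[OF eq, of "\<lambda>t. wh [Dn] t []"] by (simp add: wh_comp)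
  have e2: "wh [] (tau (cd f)) [Up] \<cdot> wh [Dn] f [Up] = wh [] f [Dn, Up] \<cdot> wh [] (tau (dm f)) [Up]"
    using arg_cong[OF tau_nat[OF assms], of "\<lambda>t. wh [] t [Up]"] by (simp add: wh_comp)
  show ?thesis
    by (simp add: pair_braid_def comp_assoc e1 comp2[OF e2])
qed

text \<open>Bending the downward strand up with \<open>cup\<close> is undone by \<open>cap\<close>,
  by \<open>zigzag_dn\<close>. Equations between maps out of Dn may thus be checked on maps out of
  the unit, where the cup is free to slide.\<close>

lemma mate_inj:
  assumes "has_parity False f" "has_parity False g" "dm f = [Dn]" "dm g = [Dn]" "cd f = cd g"
    and eq: "wh [Up] f [] \<cdot> cup = wh [Up] g [] \<cdot> cup"
  shows "f = g"
proof -
  have "wh [] cap (cd h) \<cdot> wh [Dn] (wh [Up] h [] \<cdot> cup) [] = h" if h: "has_parity False h" "dm h = [Dn]" for h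
  proof -
    note [simp] = h has_parity_mor[OF h(1)]
    have "wh [] cap (cd h) \<cdot> wh [Dn, Up] h [] = h \<cdot> wh [] cap [Dn]"
      using exch_even[of cap h "[]" "[]" "[]"] by simp
    from comp2[OF this] show ?thesis by (simp add: wh_comp comp_assoc zigzag_dn)
  qed
  then show ?thesis using assms by metis
qed

lemma pair_braid_cupR_up: "pair_braid [Up] \<cdot> wh [] cupR [Up] = wh [Up] cupR []"
proof -
  have tU: "tau [Up] = lp" by (simp add: tau_def lp_def)
  have tUU: "tau [Up, Up] = wh [Up] lp [] \<cdot> wh [] lp [Up]"
    using tau_append[of "[Up]" "[Up]"] by (simp add: tU)
  \<comment> \<open>\<open>K\<close> is what stays of the left-hand side after the cup is pulled
    through the upward strand. The braid relation with one downward strand, \<open>B\<close> below,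
    rewrites it as two crossings, and the \<open>um\<close> among them cancels the \<open>up\<close>
    left by the pulled cup.\<close>
  define K where "K = wh [] lp [Up] \<cdot> wh [Dn] um [] \<cdot> wh [] rm [Up] \<cdot> wh [Up] rm []"
  have w: "wh [] lp [Up] \<cdot> wh [] rm [Up] = \<iota> [Up, Dn, Up]" "wh [Up] lp [] \<cdot> wh [Up] rm [] = \<iota> [Up, Up, Dn]"
    "wh [Up] rm [] \<cdot> wh [Up] lp [] = \<iota> [Up, Dn, Up]"
    "wh [Dn] up [] \<cdot> wh [Dn] um [] = \<iota> [Dn, Up, Up]" "wh [] um [Dn] \<cdot> wh [] up [Dn] = \<iota> [Up, Up, Dn]"
    using arg_cong[OF lp_rm, of "\<lambda>t. wh [] t [Up]"] arg_cong[OF lp_rm, of "\<lambda>t. wh [Up] t []"]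
      arg_cong[OF rm_lp, of "\<lambda>t. wh [Up] t []"]
      arg_cong[OF up_um, of "\<lambda>t. wh [Dn] t []"] arg_cong[OF um_up, of "\<lambda>t. wh [] t [Dn]"]
    by (simp_all add: wh_comp)
  have mK [simp]: "mor K" "dm K = [Up, Up, Dn]" "cd K = [Up, Dn, Up]"
    by (simp_all add: K_def)
  have B: "wh [Up] lp [] \<cdot> wh [] lp [Up] \<cdot> wh [Dn] up [] = wh [] up [Dn] \<cdot> wh [Up] lp [] \<cdot> wh [] lp [Up]"
    using tau_nat[OF natural_up] by (simp add: tUU comp_assoc)
  have "wh [] up [Dn] \<cdot> wh [Up] lp [] \<cdot> K =
      (wh [] up [Dn] \<cdot> wh [Up] lp [] \<cdot> wh [] lp [Up]) \<cdot> wh [Dn] um [] \<cdot> wh [] rm [Up] \<cdot> wh [Up] rm []"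
    by (simp add: K_def comp_assoc)
  also have "\<dots> = \<iota> [Up, Up, Dn]"
    by (simp only: B[symmetric] comp_assoc comp2[OF w(4)]) (simp add: comp2[OF w(1)] w(2))
  finally have "wh [Up] rm [] \<cdot> wh [] um [Dn] \<cdot> wh [] up [Dn] \<cdot> wh [Up] lp [] \<cdot> K = wh [Up] rm [] \<cdot> wh [] um [Dn]"
    by simp
  then have K: "K = wh [Up] rm [] \<cdot> wh [] um [Dn]"
    by (simp add: comp2[OF w(5)] comp2[OF w(3)])
  have cup: "wh [] cup [Up] = wh [Up] rm [] \<cdot> wh [] up [Dn] \<cdot> wh [Up] cup []"
    using rot_cup[of up "[Up]", folded lp_def, THEN arg_cong, of "\<lambda>t. wh [Up] rm [] \<cdot> t"]
    by (simp add: comp2[OF w(3)])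
  have "pair_braid [Up] \<cdot> wh [] cupR [Up] = K \<cdot> wh [] up [Dn] \<cdot> wh [Up] cup []"
    unfolding pair_braid_def tU half_braid_Up cupR_def K_def by (simp add: wh_comp comp_assoc cup)
  also have "\<dots> = wh [Up] cupR []"
    unfolding K by (simp add: comp_assoc comp2[OF w(5)] cupR_def wh_comp)
  finally show ?thesis .
qed

lemma pair_braid_cupR_dn: "pair_braid [Dn] \<cdot> wh [] cupR [Dn] = wh [Dn] cupR []"
proof (rule mate_inj)
  have s: "pair_braid [Up, Dn] = wh [Up] (pair_braid [Dn]) [] \<cdot> wh [] (pair_braid [Up]) [Dn]"
    using pair_braid_append[of "[Up]" "[Dn]"] by simp
  have e1: "wh [] (pair_braid [Up]) [Dn] \<cdot> wh [] cupR [Up, Dn] = wh [Up] cupR [Dn]"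
    using arg_cong[OF pair_braid_cupR_up, of "\<lambda>t. wh [] t [Dn]"] by (simp add: wh_comp)
  have e2: "wh [] cupR [Up, Dn] \<cdot> cup = wh [Dn, Up] cup [] \<cdot> cupR"
    using exch_even[of cupR cup "[]" "[]" "[]"] by simp
  \<comment> \<open>Before the cup is created there is nothing to cross:
    \<open>pair_braid []\<close> is an identity.\<close>
  have e3: "pair_braid [Up, Dn] \<cdot> wh [Dn, Up] cup [] = wh [] cup [Dn, Up]"
    using pair_braid_nat[OF natural_cup] by simp
  have e4: "wh [] cup [Dn, Up] \<cdot> cupR = wh [Up, Dn] cupR [] \<cdot> cup"
    using exch_even[of cup cupR "[]" "[]" "[]"] by simp
  have "wh [Up] (pair_braid [Dn] \<cdot> wh [] cupR [Dn]) [] \<cdot> cup = pair_braid [Up, Dn] \<cdot> wh [] cupR [Up, Dn] \<cdot> cup"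
    by (simp add: wh_comp comp_assoc s comp2[OF e1])
  also have "\<dots> = wh [Up] (wh [Dn] cupR []) [] \<cdot> cup"
    by (simp add: e2 comp2[OF e3] e4)
  finally show "wh [Up] (pair_braid [Dn] \<cdot> wh [] cupR [Dn]) [] \<cdot> cup = wh [Up] (wh [Dn] cupR []) [] \<cdot> cup" .
qed simp_all

lemma pair_braid_cupR: "pair_braid X \<cdot> wh [] cupR X = wh X cupR []"
proof (induction X)
  case (Cons a X)
  have "pair_braid [a] \<cdot> wh [] cupR [a] = wh [a] cupR []"
    by (cases a) (simp_all only: pair_braid_cupR_up pair_braid_cupR_dn)
  from arg_cong[OF this, of "\<lambda>t. wh [] t X"]
  have e: "wh [] (pair_braid [a]) X \<cdot> wh [] cupR (a # X) = wh [a] cupR X" by (simp add: wh_comp)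
  have "wh [a] (pair_braid X) [] \<cdot> wh [a] cupR X = wh (a # X) cupR []"
    using arg_cong[OF Cons, of "\<lambda>t. wh [a] t []"] by (simp add: wh_comp)
  then show ?case using pair_braid_append[of "[a]" X] by (simp add: comp_assoc e)
qed simp

text \<open>The dot slides through \<open>up\<close> inside \<open>lp\<close>, hence through the
  inverse of \<open>lp\<close>. This moves the dot of the vanishing bubble onto the upward strand of
  \<open>cupR\<close>.\<close>

lemma rm_c: "rm \<cdot> wh [] c [Dn] = wh [Dn] c [] \<cdot> rm"
proof -
  have e1: "wh [Dn, Up] cup [] \<cdot> wh [Dn] c [] = wh [Dn] c [Up, Dn] \<cdot> wh [Dn, Up] cup []"
    using exch[of True c False cup "[Dn]" "[]" "[]"] by simp
  have e2: "wh [Dn] up [Dn] \<cdot> wh [Dn] c [Up, Dn] = wh [Dn, Up] c [Dn] \<cdot> wh [Dn] up [Dn]"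
    using arg_cong[OF up_c, of "\<lambda>t. wh [Dn] t [Dn]"] by (simp add: wh_comp)
  have e3: "wh [] cap [Up, Dn] \<cdot> wh [Dn, Up] c [Dn] = wh [] c [Dn] \<cdot> wh [] cap [Up, Dn]"
    using exch[of False cap True c "[]" "[]" "[Dn]"] by simp
  have e: "lp \<cdot> wh [Dn] c [] = wh [] c [Dn] \<cdot> lp"
    by (simp add: lp_def rot_def comp_assoc e1 comp2[OF e2] comp2[OF e3])
  have "rm \<cdot> wh [] c [Dn] = rm \<cdot> (wh [] c [Dn] \<cdot> lp) \<cdot> rm"
    by (simp add: comp_assoc lp_rm)
  also have "\<dots> = wh [Dn] c [] \<cdot> rm"
    by (simp add: e[symmetric] comp_assoc comp2[OF rm_lp])
  finally show ?thesis .
qed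

text \<open>The natural transformation by which the affine dot acts.\<close>

definition dot_act where "dot_act X = half_braid' X \<cdot> wh X c [] \<cdot> half_braid X"

lemma dot_act_typ [simp]: "has_parity True (dot_act X)" "mor (dot_act X)" "dm (dot_act X) = Up # X" "cd (dot_act X) = Up # X"
proof -
  have "has_parity True (wh X c [] \<cdot> half_braid X)"
    using has_parity_comp[of True "wh X c []" False "half_braid X"] by (simp add: has_parity_mor[OF odd_c])
  then show "has_parity True (dot_act X)"
    using has_parity_comp[of False "half_braid' X" True "wh X c [] \<cdot> half_braid X"] by (simp add: dot_act_def has_parity_mor[OF odd_c])
qed (simp_all add: dot_act_def has_parity_mor[OF odd_c])

lemma dot_act_Cons: "dot_act (a # X) = wh [] (braiding' a) X \<cdot> wh [a] (dot_act X) [] \<cdot> wh [] (braiding a) X"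
  by (simp add: dot_act_def wh_comp comp_assoc has_parity_mor[OF odd_c])

lemma dot_act_dot_act: "dot_act X \<cdot> dot_act X = (- 1) \<star> \<iota> (Up # X)"
proof -
  have "wh X c [] \<cdot> wh X c [] = (- 1) \<star> \<iota> (X @ [Up])"
    using arg_cong[OF c_c, of "\<lambda>t. wh X t []"] by (simp add: wh_comp has_parity_mor[OF odd_c])
  from comp2[OF this] show ?thesis
    by (simp add: dot_act_def comp_assoc comp2[OF half_braid_inv'] has_parity_mor[OF odd_c] half_braid_inv)
qed

text \<open>The half-braidings are even, so \<open>f\<close> passes them without a sign; the sign
  arises where \<open>f\<close> is exchanged with c on the last strand.\<close>

lemma dot_act_nat:
  assumes "natural p f"
  shows "dot_act (cd f) \<cdot> wh [Up] f [] = koszul_sign True p \<star> wh [Up] f [] \<cdot> dot_act (dm f)"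
proof -
  have h: "has_parity p f" and eq: "half_braid (cd f) \<cdot> wh [Up] f [] = wh [] f [Up] \<cdot> half_braid (dm f)"
    using assms by (auto simp: natural_def)
  note [simp] = has_parity_mor[OF h]
  have e: "wh (cd f) c [] \<cdot> wh [] f [Up] = koszul_sign True p \<star> wh [] f [Up] \<cdot> wh (dm f) c []"
    using exch[of p f True c "[]" "[]" "[]"] h by (cases p) simp_all
  have "half_braid' (cd f) \<cdot> wh [] f [Up] = half_braid' (cd f) \<cdot> (wh [] f [Up] \<cdot> half_braid (dm f)) \<cdot> half_braid' (dm f)"
    by (simp add: comp_assoc half_braid_inv')
  also have "\<dots> = wh [Up] f [] \<cdot> half_braid' (dm f)"
    by (simp add: eq[symmetric] comp_assoc comp2[OF half_braid_inv])
  finally have e': "half_braid' (cd f) \<cdot> wh [] f [Up] = wh [Up] f [] \<cdot> half_braid' (dm f)" .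
  show ?thesis
    by (simp add: dot_act_def comp_assoc eq comp2[OF e] comp2[OF e'])
qed

text \<open>Pulled through the cap, the factor \<open>half_braid'\<close> of \<open>dot_act\<close>
  becomes \<open>tau\<close>. With the factor \<open>half_braid\<close> it makes up
  \<open>pair_braid\<close>, which carries \<open>cupR\<close> through X and leaves a bubble with c
  to the right of X.\<close>

lemma dot_act_bubble: "wh [] cap X \<cdot> wh [Dn] (dot_act X) [] \<cdot> wh [] cupR X = \<zeta> X X"
proof -
  have e1: "wh [] cap X \<cdot> wh [Dn] (half_braid' X) [] = wh X cap [] \<cdot> wh [] (tau X) [Up]"
    using rot_cap[of "half_braid' X" X] by (simp add: tau_def)
  have e2: "wh [] (tau X) [Up] \<cdot> wh (Dn # X) c [] = wh (X @ [Dn]) c [] \<cdot> wh [] (tau X) [Up]"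
    using exch[of False "tau X" True c "[]" "[]" "[]"] by simp
  have "cap \<cdot> wh [Dn] c [] \<cdot> cupR = \<zeta> [] []"
    using bubble_c comp2[OF rm_c, of cup] by (simp add: cupR_def comp_assoc)
  from arg_cong[OF this, of "\<lambda>t. wh X t []"]
  have e3: "wh X cap [] \<cdot> wh (X @ [Dn]) c [] \<cdot> wh X cupR [] = \<zeta> X X"
    by (simp add: wh_comp)
  have "wh [] cap X \<cdot> wh [Dn] (dot_act X) [] \<cdot> wh [] cupR X =
      wh X cap [] \<cdot> wh (X @ [Dn]) c [] \<cdot> pair_braid X \<cdot> wh [] cupR X"
    by (simp add: dot_act_def wh_comp comp_assoc comp2[OF e1] comp2[OF e2] pair_braid_def)
  then show ?thesis by (simp add: pair_braid_cupR e3)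
qed


section \<open>The action of the affine supercategory\<close>

lemma AQ_pres_simps [simp]:
  "gsrc (AQ_pres z) = case_aqgen q_src [Up]" "gtgt (AQ_pres z) = case_aqgen q_tgt [Up]"
  "gpar (AQ_pres z) = case_aqgen q_par True" "rels (AQ_pres z) = AQ_rels z"
  by (simp_all add: AQ_pres_def)

abbreviation "asrc \<equiv> src (AQ_pres z)"
abbreviation "atgt \<equiv> tgt (AQ_pres z)"

text \<open>
  \<open>act f X\<close> is the component at \<open>X\<close> of the natural transformation by which \<open>f\<close> acts.
  The clause for \<open>\<otimes>\<close> is horizontal composition, and the interchange law is naturality.
\<close>

primrec act :: "('k, ori, aqgen) trm \<Rightarrow> ori list \<Rightarrow> 'k Q_mor" where
  "act (Gen g) X = (case g of Q_gen h \<Rightarrow> wh [] (gen h) X | O_dot \<Rightarrow> dot_act X)"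
| "act (Id V) X = \<iota> (V @ X)"
| "act (Zero V W) X = \<zeta> (V @ X) (W @ X)"
| "act (Add f g) X = act f X \<boxplus> act g X"
| "act (Scale a f) X = a \<star> act f X"
| "act (f \<bullet> g) X = act f X \<cdot> act g X"
| "act (f \<otimes> g) X = act f (atgt g @ X) \<cdot> wh (asrc f) (act g X) []"

lemma act_typ [simp]:
  assumes "wt (AQ_pres z) f"
  shows "mor (act f X)" "dm (act f X) = asrc f @ X" "cd (act f X) = atgt f @ X"
proof -
  have "mor (act f X) \<and> dm (act f X) = asrc f @ X \<and> cd (act f X) = atgt f @ X"
    using assms by (induction f arbitrary: X) (auto split: aqgen.split)
  then show "mor (act f X)" "dm (act f X) = asrc f @ X" "cd (act f X) = atgt f @ X" by auto
qed

lemma has_parity_gen: "has_parity (q_par g) (gen g)"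
  by (auto intro!: has_parity_cls homog_Gen)

lemma act_homog: "homog (AQ_pres z) p f \<Longrightarrow> wt (AQ_pres z) f \<Longrightarrow> has_parity p (act f X)"
proof (induction arbitrary: X rule: homog.induct)
  case (1 g)
  then show ?case by (auto simp: has_parity_gen split: aqgen.split)
next
  case (6 p f q g)
  then show ?case using has_parity_comp[of p "act f X" q "act g X"] by simp
next
  case (7 p f q g)
  then show ?case
    using has_parity_comp[of p "act f (atgt g @ X)" q "wh (asrc f) (act g X) []"] by simp
qed (auto simp: has_parity_add)

lemma natural_has_parity: "has_parity p h \<Longrightarrow> natural p h"
  using natural_cls by (auto simp: has_parity_def)

text \<open>Generators of Q act by whiskering on the side away from \<open>h\<close>, so
  \<open>exch\<close> covers them; o is the case of \<open>dot_act_nat\<close>. The rest of the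
  induction multiplies signs.\<close>

lemma act_nat:
  assumes "homog (AQ_pres z) p f" "wt (AQ_pres z) f" "has_parity q h"
  shows "act f (cd h) \<cdot> wh (asrc f) h [] = koszul_sign p q \<star> wh (atgt f) h [] \<cdot> act f (dm h)"
  using assms
proof (induction arbitrary: q h rule: homog.induct)
  case (1 g)
  note [simp] = has_parity_mor[OF 1(2)]
  show ?case
  proof (cases g)
    case (Q_gen x)
    then show ?thesis
      using exch[OF has_parity_gen 1(2), of "[]" x "[]" "[]"] by simp
  next
    case O_dot
    then show ?thesis using dot_act_nat[OF natural_has_parity[OF 1(2)]] by simp
  qed
next
  case (2 X)
  then show ?case by (simp add: has_parity_mor)
next
  case (3 p X Y)
  then show ?case by (simp add: has_parity_mor)
next
  case (4 p f g)
  note [simp] = has_parity_mor[OF 4(6)]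
  show ?case using 4 by (simp add: add_comp comp_add scale_add)
next
  case (5 p f a)
  then show ?case by (simp add: has_parity_mor mult.commute)
next
  case (6 p f p' g)
  note [simp] = has_parity_mor[OF 6(6)]
  have w: "wt (AQ_pres z) f" "wt (AQ_pres z) g" "asrc f = atgt g" using 6 by auto
  note f = 6(3)[OF w(1) 6(6)] and g = 6(4)[OF w(2) 6(6)]
  show ?case
    by (simp add: w comp_assoc f g comp2[OF f[unfolded w(3)]]) (cases p; cases p'; cases q; simp)
next
  case (7 p f p' g)
  note [simp] = has_parity_mor[OF 7(6)]
  have w [simp]: "wt (AQ_pres z) f" "wt (AQ_pres z) g" using 7 by auto
  \<comment> \<open>The induction hypothesis for \<open>f\<close> is taken at \<open>h\<close>
    whiskered by the target of \<open>g\<close>, which is why \<open>h\<close> is kept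
    general.\<close>
  have f: "act f (atgt g @ cd h) \<cdot> wh (asrc f @ atgt g) h [] =
      koszul_sign p q \<star> wh (atgt f @ atgt g) h [] \<cdot> act f (atgt g @ dm h)"
    using 7(3)[OF w(1) has_parity_wh[OF 7(6), of "atgt g" "[]"]] by simp
  have g: "wh (asrc f) (act g (cd h)) [] \<cdot> wh (asrc f @ asrc g) h [] =
      koszul_sign p' q \<star> wh (asrc f @ atgt g) h [] \<cdot> wh (asrc f) (act g (dm h)) []"
    using arg_cong[OF 7(4)[OF w(2) 7(6)], of "\<lambda>t. wh (asrc f) t []"] by (simp add: wh_comp)
  show ?case
    by (simp add: comp_assoc f g comp2[OF f]) (cases p; cases p'; cases q; simp)
qed

section \<open>Restriction of the action to Q and invariance under equivalence\<close>

lemma rename_typ [simp]: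
  "asrc (rename Q_gen f) = src (Q_pres z) f" "atgt (rename Q_gen f) = tgt (Q_pres z) f"
  by (induction f) auto

lemma rename_wt [simp]: "wt (AQ_pres z) (rename Q_gen f) = wt (Q_pres z) f"
  by (induction f) auto

text \<open>The tensor clause of \<open>act\<close> has the order of factors of
  \<open>tens_eq\<close>, so tensor products agree without signs. At the empty word the class of
  \<open>f\<close> itself appears.\<close>

lemma act_rename: "wt (Q_pres z) f \<Longrightarrow> act (rename Q_gen f) X = wh [] (cls (Q_pres z) f) X"
proof (induction f arbitrary: X)
  case (Add f g)
  then show ?case by (simp add: cls_Add wh_add)
next
  case (Scale a f)
  then show ?case by (simp add: cls_Scale)
next
  case (Comp f g)
  then show ?case by (simp add: cls_Comp wh_comp)
next
  case (Tens f g)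
  then show ?case by (simp add: cls_Tens tens_eq wh_comp)
qed simp_all

lemma act_rels:
  assumes "(l, r) \<in> AQ_rels z" shows "act l X = act r X"
proof -
  consider l' r' where "(l', r') \<in> Q_rels z" "l = rename Q_gen l'" "r = rename Q_gen r'"
    | "l = dot_o \<bullet> dot_o" "r = Scale (- 1) id_up"
    | "l = rename Q_gen u_plus \<bullet> (id_up \<otimes> dot_o)" "r = (dot_o \<otimes> id_up) \<bullet> rename Q_gen u_plus"
    | "l = rename Q_gen cap_R \<bullet> (dot_o \<otimes> id_dn) \<bullet> rename Q_gen cup_L" "r = Zero [] []"
    using assms unfolding AQ_rels_def by auto
  then show ?thesis
  proof cases
    case (1 l' r')
    then have "wt (Q_pres z) l'" "wt (Q_pres z) r'"
      using admissible_Q[of z] by (force simp: admissible_def)+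
    then show ?thesis using cls_rel[OF 1(1)] 1 by (simp add: act_rename)
  next
    case 2
    then show ?thesis by (simp add: dot_act_dot_act)
  next
    case 3
    \<comment> \<open>By the recursion for \<open>dot_act\<close>, o on Up Up X is the conjugate of
      o on Up X by \<open>um\<close>, so only the cancellation of \<open>um\<close> against
      \<open>up\<close> is left.\<close>
    have "wh [] um X \<cdot> wh [] up X = \<iota> (Up # Up # X)"
      using arg_cong[OF um_up, of "\<lambda>t. wh [] t X"] by (simp add: wh_comp)
    then show ?thesis using 3 by (simp add: dot_act_Cons comp_assoc)
  next
    case 4
    \<comment> \<open>\<open>rm\<close> does not invert \<open>lm\<close> exactly, but after
      composing with the cap the difference contains the bubble and vanishes. The term with z in
      \<open>rp\<close> dies in the same way on the cup, in \<open>e2\<close>.\<close>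
    have e1: "wh [] cap X \<cdot> wh [] rm X \<cdot> wh [] lm X = wh [] cap X"
    proof -
      have "cap \<cdot> rm \<cdot> lm = cap"
        by (simp add: lm_eq comp_add rm_lp comp3[OF bubble])
      from arg_cong[OF this, of "\<lambda>t. wh [] t X"] show ?thesis by (simp add: wh_comp)
    qed
    have e2: "wh [] rp X \<cdot> wh [] cup X = wh [] cupR X"
    proof -
      have "rp \<cdot> cup = cupR"
        by (simp add: rp_def add_comp comp_assoc bubble cupR_def)
      from arg_cong[OF this, of "\<lambda>t. wh [] t X"] show ?thesis by (simp add: wh_comp)
    qed
    show ?thesis
      using 4 dot_act_bubble[of X]
      by (simp add: dot_act_Cons comp_assoc cap_R_def comp3[OF e1] e2)
  qed
qed

lemma act_eqv: "eqv (AQ_pres z) f g \<Longrightarrow> act f X = act g X"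
proof (induction arbitrary: X rule: eqv.induct)
  case (rel l r)
  then show ?case by (simp add: act_rels)
next
  case (cong_Tens f f' g g')
  \<comment> \<open>The tensor clause of \<open>act\<close> reads a source and a target off the
    terms, so these must be invariant under equivalence.\<close>
  from cong_Tens(1,2) have "asrc f = asrc f'" "atgt g = atgt g'"
    using eqv_typed[OF admissible_AQ] by blast+
  with cong_Tens show ?case by simp
next
  case (Add_assoc f g h)
  then have "wt (AQ_pres z) f" "wt (AQ_pres z) g" "wt (AQ_pres z) h" "asrc g = asrc f" "asrc h = asrc f"
    "atgt g = atgt f" "atgt h = atgt f" by auto
  then show ?case by (simp add: add_assoc)
next
  case (Add_commute f g)
  then show ?case using smc.add_commute[of "act f X" "asrc f @ X" "atgt f @ X" "act g X"] by (simp add: hom_iff)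
next
  case (Add_zero V W f)
  then show ?case by (simp add: arrow_def)
next
  case (Add_neg V W f)
  then show ?case using add_cancel[of "act f X" 1] by (auto simp: arrow_def)
next
  case (Scale_add f g a)
  then show ?case by (simp add: scale_add)
next
  case (Scale_plus f a b)
  then show ?case using smc.scale_plus[of "act f X" "asrc f @ X" "atgt f @ X" a b] by (simp add: hom_iff)
next
  case (Comp_assoc f g h)
  then show ?case by (simp add: comp_assoc)
next
  case (Id_Comp V W f)
  then show ?case by (auto simp: arrow_def)
next
  case (Comp_Id V W f)
  then show ?case by (auto simp: arrow_def)
next
  case (Comp_Add_left f f' g)
  then have "wt (AQ_pres z) f" "wt (AQ_pres z) f'" "wt (AQ_pres z) g" "asrc f = atgt g" "asrc f' = atgt g"
    "atgt f' = atgt f" by auto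
  then show ?case by (simp add: add_comp)
next
  case (Comp_Add_right f g g')
  then show ?case by (simp add: comp_add)
next
  case (Tens_assoc f g h)
  then show ?case by (simp add: comp_assoc wh_comp)
next
  case (Tens_Add_left f f' g)
  then show ?case by (simp add: add_comp)
next
  case (Tens_Add_right f g g')
  then show ?case by (simp add: comp_add wh_add)
next
  case (Interchange f' f g g' p q)
  then have w: "wt (AQ_pres z) f" "wt (AQ_pres z) f'" "wt (AQ_pres z) g" "wt (AQ_pres z) g'"
    "asrc f' = atgt f" "asrc g = atgt g'"
    by auto
  \<comment> \<open>Naturality of the action of \<open>f\<close> at the morphism of Q by which
    \<open>g\<close> acts.\<close>
  have e: "act f (atgt g @ X) \<cdot> wh (asrc f) (act g X) [] =
      koszul_sign p q \<star> wh (atgt f) (act g X) [] \<cdot> act f (asrc g @ X)"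
    using act_nat[OF Interchange(3) w(1) act_homog[OF Interchange(4) w(3), of X]] w by simp
  show ?case
    by (simp add: w comp_assoc wh_comp comp2[OF e[unfolded w]]) (cases p; cases q; simp add: w)
qed (simp_all)

end

theorem proposition7p7:
  fixes z :: "'k::comm_ring_1"
  assumes "CHAR('k) \<noteq> 2"
  shows "faithful (Q z) (Q_to_AQ z)"
proof -
  interpret quantum_isomeric z .
  show ?thesis
    unfolding faithful_def
  proof (intro allI inj_onI)
    fix X Y a b
    assume "a \<in> hom (Q z) X Y" "b \<in> hom (Q z) X Y" and eq: "Q_to_AQ z a = Q_to_AQ z b"
    then obtain f g where f: "wt (Q_pres z) f" "a = cls (Q_pres z) f"
      and g: "wt (Q_pres z) g" "b = cls (Q_pres z) g"
      by (auto simp: Q_def presented_simps[OF admissible_Q] arrow_def)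
    have ind: "Q_to_AQ z (cls (Q_pres z) h) = cls (AQ_pres z) (rename Q_gen h)"
      if "wt (Q_pres z) h" for h
      unfolding Q_to_AQ_def by (rule induced_cls[OF admissible_Q admissible_AQ AQ_extends that])
    have "cls (AQ_pres z) (rename Q_gen f) = cls (AQ_pres z) (rename Q_gen g)"
      using eq f g by (simp add: ind)
    then have "eqv (AQ_pres z) (rename Q_gen f) (rename Q_gen g)"
      using cls_eq[OF admissible_AQ, of z "rename Q_gen f"] f by simp
    from act_eqv[OF this, of "[]"] show "a = b"
      using f g by (simp add: act_rename)
  qed
qed

end
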